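(* The number of reduced words $\mathrm{rw}(w)=|\mathrm{RW}(w)|$ is a pattern-positive statistic, and for every permutation $p$ the coefficient of $[p]$ in its pattern expansion is the number of essential reduced words for $p$.
   Context: $S_n$ is the set of permutations of $[1,n]=\{1,\dots,n\}$ (with $S_0=\{\varnothing\}$), and $\mathcal{S}=\bigsqcup_{n\ge 0}S_n$. For $w\in S_n$ and $I=\{a_1<\dots<a_h\}\subseteq[1,n]$, $w|_I\in S_h$ is the permutation whose entries are in the same relative order as $w(a_1)\cdots w(a_h)$. The pattern-count function $[p]\colon\mathcal{S}\to\mathbb{N}$ sends $w\in S_n$ to the number of $I\subseteq[1,n]$ with $w|_I=p$. Every statistic $\sigma\colon\mathcal{S}\to\mathbb{Z}$ has a unique pattern expansion $\sigma=\sum_{p\in\mathcal{S}}\sigma_p\cdot[p]$ with $\sigma_p\in\mathbb{Z}$ (finite when evaluated at any $w$); $\sigma$ is pattern-positive if all $\sigma_p\ge 0$. A reduced word for $w\in S_n$ is an expression $w=s_{i_\ell}\cdots s_{i_1}$ of minimal length as a product of adjacent transpositions, where $s_i$ exchanges $i$ and $i+1$ and products are function compositions (read right to left); $\mathrm{RW}(w)$ is the set of reduced words of $w$. An inversion of $w$ is a pair of indices $a<b$ with $w(a)>w(b)$. The letter $s_{i_k}$ in a reduced word $s_{i_\ell}\cdots s_{i_1}$ creates the inversion $(a,b)$ if $(a,b)$ is an inversion of $s_{i_k}\cdots s_{i_1}$ but not of $s_{i_{k-1}}\cdots s_{i_1}$; explicitly, $s_{i_{k-1}}\cdots s_{i_1}(a)=i_k$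 and $s_{i_{k-1}}\cdots s_{i_1}(b)=i_k+1$. Thus a reduced word of $w$ is determined by the order in which it creates the inversions of $w$. For $I\subseteq[1,n]$, the restriction map $\pi_I\colon\mathrm{RW}(w)\to\mathrm{RW}(w|_I)$ records only the inversions between indices in $I$, in the order in which they are created: a letter $s_{i_k}$ creating $(a,b)$ is deleted unless $a,b\in I$, in which case it is replaced by $s_j$ with $j=\#\{c\in I: s_{i_{k-1}}\cdots s_{i_1}(c)\le i_k\}$. These maps are surjective. The minimal lift of $x\in\mathrm{RW}(w|_I)$ to $w$ is the reduced word $\iota_I(x)=s_{i_\ell}\cdots s_{i_1}\in\pi_I^{-1}(x)$ whose index sequence $(i_1,\dots,i_\ell)$ (read from the right end of the word) is lexicographically minimal among all elements of $\pi_I^{-1}(x)$. A reduced word for $w\in S_n$ is essential if it is not in the image of the minimal lift map $\iota_I\colon\mathrm{RW}(w|_I)\to\mathrm{RW}(w)$ for any proper subset $I\subsetneq[1,n]$ (the empty set $I=\varnothing$ included when $n\ge 1$). *)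

theory Defs
  imports Main "HOL-Combinatorics.Permutations" "HOL-Library.List_Lexorder"
begin

section \<open>Permutations, restrictions and pattern expansions\<close>

text \<open>
  A permutation of \<open>{1..n}\<close> is a pair \<open>(n, w)\<close> with \<open>w permutes {1..n}\<close>. The size is kept because
  the same function \<open>w\<close> lies in several of the \<open>S\<^sub>n\<close>.
\<close>

type_synonym perm = "nat \<times> (nat \<Rightarrow> nat)"

definition perms :: "perm set" where
  "perms = (SIGMA n:UNIV. {w. w permutes {1..n}})"

definition nth_elem :: "nat set \<Rightarrow> nat \<Rightarrow> nat" where
  "nth_elem I j = sorted_list_of_set I ! (j - 1)"  \<comment> \<open>\<open>a\<^sub>j\<close> in \<open>I = {a\<^sub>1 < \<dots> < a\<^sub>h}\<close>\<close>

fun restrict_perm :: "perm \<Rightarrow> nat set \<Rightarrow> perm" where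
  "restrict_perm (n, w) I =
     (card I, THE v. v permutes {1..card I} \<and>
        (\<forall>i\<in>{1..card I}. \<forall>j\<in>{1..card I}.
           v i < v j \<longleftrightarrow> w (nth_elem I i) < w (nth_elem I j)))"

definition pattern_count :: "perm \<Rightarrow> perm \<Rightarrow> nat" where
  "pattern_count p w = card {I. I \<subseteq> {1..fst w} \<and> restrict_perm w I = p}"

text \<open>
  A statistic is a function on \<open>perm\<close> of which only the values on \<open>perms\<close> matter, and likewise for
  a family of coefficients. The sum over all patterns is written as the sum over those that occur
  in \<open>w\<close>, which are finite in number (\<open>finite_patterns\<close> below).
\<close>

definition pattern_expansion :: "(perm \<Rightarrow> int) \<Rightarrow> (perm \<Rightarrow> int) \<Rightarrow> bool" where
  "pattern_expansion \<sigma> c \<longleftrightarrow>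
     (\<forall>w\<in>perms. \<sigma> w = (\<Sum>p | p \<in> perms \<and> pattern_count p w \<noteq> 0. c p * int (pattern_count p w)))"

definition pattern_coeff :: "(perm \<Rightarrow> int) \<Rightarrow> perm \<Rightarrow> int" where
  "pattern_coeff \<sigma> p = (THE k. \<exists>c. pattern_expansion \<sigma> c \<and> c p = k)"

definition pattern_positive :: "(perm \<Rightarrow> int) \<Rightarrow> bool" where
  "pattern_positive \<sigma> \<longleftrightarrow> (\<forall>p\<in>perms. pattern_coeff \<sigma> p \<ge> 0)"

section \<open>Reduced words\<close>

text \<open>
  The word \<open>s\<^bsub>i\<^sub>l\<^esub> \<cdots> s\<^bsub>i\<^sub>1\<^esub>\<close> is represented by its index sequence \<open>[i\<^sub>1, \<dots>, i\<^sub>l]\<close>, that is, read from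
  the right, so that the head of the list is the transposition that is applied first. Positions
  in the list are counted from 0, and \<open>word_prod (take k x)\<close> is the product of the \<open>k\<close> letters
  that precede position \<open>k\<close>.
\<close>

definition word_prod :: "nat list \<Rightarrow> nat \<Rightarrow> nat" where
  "word_prod x = fold (\<lambda>i f. transpose i (i + 1) \<circ> f) x id"

fun words_for :: "perm \<Rightarrow> nat list set" where
  "words_for (n, w) = {x. set x \<subseteq> {1..<n} \<and> word_prod x = w}"

definition RW :: "perm \<Rightarrow> nat list set" where
  "RW w = {x \<in> words_for w. \<forall>y\<in>words_for w. length x \<le> length y}"

definition rw :: "perm \<Rightarrow> nat" where
  "rw w = card (RW w)"

definition inversions :: "nat \<Rightarrow> (nat \<Rightarrow> nat) \<Rightarrow> (nat \<times> nat) set" where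
  "inversions n w = {(a, b). a \<in> {1..n} \<and> b \<in> {1..n} \<and> a < b \<and> w a > w b}"

definition creates :: "nat \<Rightarrow> nat list \<Rightarrow> nat \<Rightarrow> nat \<times> nat \<Rightarrow> bool" where
  "creates n x k ab \<longleftrightarrow>
     ab \<in> inversions n (word_prod (take (k + 1) x)) \<and> ab \<notin> inversions n (word_prod (take k x))"

definition restrict_word :: "nat \<Rightarrow> nat set \<Rightarrow> nat list \<Rightarrow> nat list" where
  "restrict_word n I x =
     map (\<lambda>k. card {c \<in> I. word_prod (take k x) c \<le> x ! k})
       (filter (\<lambda>k. \<exists>a\<in>I. \<exists>b\<in>I. creates n x k (a, b)) [0..<length x])"

text \<open>
  \<open>LEAST\<close> refers to the lexicographic order on \<open>nat list\<close>.
\<close>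

definition minimal_lift :: "perm \<Rightarrow> nat set \<Rightarrow> nat list \<Rightarrow> nat list" where
  "minimal_lift w I x = (LEAST y. y \<in> RW w \<and> restrict_word (fst w) I y = x)"

definition essential :: "perm \<Rightarrow> nat list \<Rightarrow> bool" where
  "essential w x \<longleftrightarrow>
     x \<in> RW w \<and> (\<forall>I. I \<subset> {1..fst w} \<longrightarrow> x \<notin> minimal_lift w I ` RW (restrict_perm w I))"

section \<open>Well-definedness of restrictions and pattern coefficients\<close>

lemma nth_elem_mem:
  assumes "finite I" "j \<in> {1..card I}" shows "nth_elem I j \<in> I"
proof -
  have "j - 1 < length (sorted_list_of_set I)" using assms by auto
  then have "nth_elem I j \<in> set (sorted_list_of_set I)"
    unfolding nth_elem_def by (rule nth_mem)
  then show ?thesis using assms(1) by simp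
qed

lemma bij_betw_nth_elem:
  assumes "finite I" shows "bij_betw (nth_elem I) {1..card I} I"
proof -
  have "inj_on (nth_elem I) {1..card I}"
  proof (rule inj_onI)
    fix i j assume "i \<in> {1..card I}" "j \<in> {1..card I}" "nth_elem I i = nth_elem I j"
    then have "i - 1 = j - 1"
      unfolding nth_elem_def
      by (subst (asm) nth_eq_iff_index_eq) (auto simp: assms)
    then show "i = j" using \<open>i \<in> _\<close> \<open>j \<in> _\<close> by auto
  qed
  moreover have "nth_elem I ` {1..card I} \<subseteq> I"
    using nth_elem_mem[OF assms] by auto
  ultimately show ?thesis
    using assms by (simp add: bij_betw_def card_image card_subset_eq)
qed

lemma permutes_eq_card:
  assumes "v permutes {1..h}" "j \<in> {1..h::nat}"
  shows "v j = card {i \<in> {1..h}. v i \<le> v j}"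
proof -
  have "v ` {i \<in> {1..h}. v i \<le> v j} = {1..v j}"
  proof
    show "v ` {i \<in> {1..h}. v i \<le> v j} \<subseteq> {1..v j}"
    proof (rule image_subsetI)
      fix i assume i: "i \<in> {i \<in> {1..h}. v i \<le> v j}"
      then have "v i \<in> {1..h}" using permutes_in_image[OF assms(1), of i] by blast
      then show "v i \<in> {1..v j}" using i by simp
    qed
    show "{1..v j} \<subseteq> v ` {i \<in> {1..h}. v i \<le> v j}"
    proof
      fix y assume y: "y \<in> {1..v j}"
      have "v j \<in> {1..h}" using permutes_in_image[OF assms(1), of j] assms(2) by blast
      then have "y \<in> v ` {1..h}" using y unfolding permutes_image[OF assms(1)] by simp
      then obtain i where "i \<in> {1..h}" "y = v i" by blast
      then show "y \<in> v ` {i \<in> {1..h}. v i \<le> v j}" using y by simp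
    qed
  qed
  moreover have "inj_on v {i \<in> {1..h}. v i \<le> v j}"
    using permutes_inj[OF assms(1)] by (meson inj_on_subset subset_UNIV)
  ultimately have "card {1..v j} = card {i \<in> {1..h}. v i \<le> v j}"
    by (metis card_image)
  then show ?thesis by simp
qed

lemma standardize_ex1:
  assumes "inj_on f {1..h::nat}"
  shows "\<exists>!v. v permutes {1..h} \<and>
    (\<forall>i\<in>{1..h}. \<forall>j\<in>{1..h}. v i < v j \<longleftrightarrow> (f i :: nat) < f j)"
proof (rule ex_ex1I)
  define v where "v j = (if j \<in> {1..h} then card {i \<in> {1..h}. f i \<le> f j} else j)" for j
  have less: "v i < v j" if "i \<in> {1..h}" "j \<in> {1..h}" "f i < f j" for i j
  proof -
    have "{k \<in> {1..h}. f k \<le> f i} \<subset> {k \<in> {1..h}. f k \<le> f j}"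
    proof (rule psubsetI)
      show "{k \<in> {1..h}. f k \<le> f i} \<subseteq> {k \<in> {1..h}. f k \<le> f j}" using that by auto
      have "j \<in> {k \<in> {1..h}. f k \<le> f j}" "j \<notin> {k \<in> {1..h}. f k \<le> f i}" using that by auto
      then show "{k \<in> {1..h}. f k \<le> f i} \<noteq> {k \<in> {1..h}. f k \<le> f j}" by metis
    qed
    then show ?thesis using that by (simp add: v_def psubset_card_mono)
  qed
  have iff: "v i < v j \<longleftrightarrow> f i < f j" if "i \<in> {1..h}" "j \<in> {1..h}" for i j
    using less[OF that] less[OF that(2,1)] inj_onD[OF assms _ that]
    by (metis less_asym linorder_neqE_nat)
  have "v ` {1..h} \<subseteq> {1..h}"
  proof
    fix y assume "y \<in> v ` {1..h}"
    then obtain j where j: "j \<in> {1..h}" "y = card {i \<in> {1..h}. f i \<le> f j}"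
      by (auto simp: v_def)
    have "card {i \<in> {1..h}. f i \<le> f j} \<le> card {1..h}" by (rule card_mono) auto
    moreover have "card {i \<in> {1..h}. f i \<le> f j} > 0"
      using j by (auto simp: card_gt_0_iff)
    ultimately show "y \<in> {1..h}" using j by auto
  qed
  moreover have inj: "inj_on v {1..h}"
  proof (rule inj_onI)
    fix i j assume ij: "i \<in> {1..h}" "j \<in> {1..h}" "v i = v j"
    then have "f i = f j" using iff by (metis less_irrefl linorder_neqE_nat)
    then show "i = j" using assms ij by (auto dest: inj_onD)
  qed
  ultimately have "bij_betw v {1..h} {1..h}"
    by (simp add: bij_betw_def endo_inj_surj)
  then have "v permutes {1..h}"
    by (rule bij_imp_permutes) (auto simp: v_def)
  then show "\<exists>v. v permutes {1..h} \<and> (\<forall>i\<in>{1..h}. \<forall>j\<in>{1..h}. v i < v j \<longleftrightarrow> f i < f j)"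
    using iff by blast
next
  fix u v
  assume u: "u permutes {1..h} \<and> (\<forall>i\<in>{1..h}. \<forall>j\<in>{1..h}. u i < u j \<longleftrightarrow> f i < f j)"
    and v: "v permutes {1..h} \<and> (\<forall>i\<in>{1..h}. \<forall>j\<in>{1..h}. v i < v j \<longleftrightarrow> f i < f j)"
  show "u = v"
  proof
    fix j
    show "u j = v j"
    proof (cases "j \<in> {1..h}")
      case True
      then have "{i \<in> {1..h}. u i \<le> u j} = {i \<in> {1..h}. v i \<le> v j}"
        using u v by (intro Collect_cong) (simp add: linorder_not_less[symmetric] cong: conj_cong)
      then show ?thesis
        using permutes_eq_card[of u h j] permutes_eq_card[of v h j] True u v by simp
    next
      case False
      then show ?thesis using u v by (metis permutes_not_in)
    qed
  qed
qed

lemma restrict_perm_ex1: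
  assumes "(n, w) \<in> perms" "I \<subseteq> {1..n}"
  shows "\<exists>!v. v permutes {1..card I} \<and>
    (\<forall>i\<in>{1..card I}. \<forall>j\<in>{1..card I}. v i < v j \<longleftrightarrow> w (nth_elem I i) < w (nth_elem I j))"
proof -
  have "finite I" using assms(2) finite_subset by blast
  then have "inj_on (nth_elem I) {1..card I}"
    using bij_betw_nth_elem by (simp add: bij_betw_def)
  moreover have "inj w" using assms(1) permutes_inj by (auto simp: perms_def)
  ultimately have "inj_on (w \<circ> nth_elem I) {1..card I}"
    by (intro comp_inj_on) (auto intro: inj_on_subset)
  then have "inj_on (\<lambda>i. w (nth_elem I i)) {1..card I}" unfolding comp_def .
  then show ?thesis by (rule standardize_ex1)
qed

lemma restrict_perm_in_perms:
  assumes "w \<in> perms" "I \<subseteq> {1..fst w}" shows "restrict_perm w I \<in> perms"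
proof (cases w)
  case (Pair n f)
  have "(n, f) \<in> perms" "I \<subseteq> {1..n}" using assms by (auto simp: Pair)
  define P where "P v \<longleftrightarrow> v permutes {1..card I} \<and> (\<forall>i\<in>{1..card I}. \<forall>j\<in>{1..card I}.
      v i < v j \<longleftrightarrow> f (nth_elem I i) < f (nth_elem I j))" for v :: "nat \<Rightarrow> nat"
  have "\<exists>!v. P v"
    unfolding P_def by (rule restrict_perm_ex1) fact+
  then have "P (THE v. P v)" by (rule theI')
  moreover have "v permutes {1..card I}" if "P v" for v
    using that unfolding P_def by (rule conjunct1)
  moreover have "restrict_perm w I = (card I, THE v. P v)"
    unfolding Pair restrict_perm.simps P_def by (rule refl)
  ultimately show ?thesis by (simp add: perms_def)
qed

lemma fst_restrict_perm [simp]: "fst (restrict_perm w I) = card I"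
  by (cases w) simp

lemma restrict_perm_full:
  assumes "w \<in> perms" shows "restrict_perm w {1..fst w} = w"
proof (cases w)
  case (Pair n f)
  have el: "nth_elem {1..n} i = i" if "i \<in> {1..n}" for i
  proof -
    have "sorted_list_of_set {1..n} = [1..<Suc n]"
      using sorted_list_of_set_range[of 1 "Suc n"]
      by (simp only: atLeastLessThanSuc_atLeastAtMost)
    then show ?thesis using that by (auto simp: nth_elem_def simp del: upt_Suc)
  qed
  define P where "P v \<longleftrightarrow> v permutes {1..card {1..n}} \<and>
      (\<forall>i\<in>{1..card {1..n}}. \<forall>j\<in>{1..card {1..n}}.
        v i < v j \<longleftrightarrow> f (nth_elem {1..n} i) < f (nth_elem {1..n} j))" for v :: "nat \<Rightarrow> nat"
  have "\<exists>!v. P v"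
    unfolding P_def using assms by (intro restrict_perm_ex1) (auto simp: Pair)
  moreover have "P f"
    using assms by (simp add: Pair perms_def P_def el del: One_nat_def)
  ultimately have "(THE v. P v) = f" by (intro the1_equality[of P f])
  moreover have "restrict_perm w {1..fst w} = (card {1..n}, THE v. P v)"
    unfolding Pair restrict_perm.simps P_def fst_conv by (rule refl)
  ultimately show ?thesis by (simp add: Pair)
qed

lemma finite_patterns: "finite {p. p \<in> perms \<and> pattern_count p w \<noteq> 0}"
proof (rule finite_subset)
  show "{p. p \<in> perms \<and> pattern_count p w \<noteq> 0} \<subseteq> restrict_perm w ` Pow {1..fst w}"
  proof
    fix p assume "p \<in> {p. p \<in> perms \<and> pattern_count p w \<noteq> 0}"
    then have "{I. I \<subseteq> {1..fst w} \<and> restrict_perm w I = p} \<noteq> {}"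
      unfolding pattern_count_def by (auto intro: ccontr)
    then show "p \<in> restrict_perm w ` Pow {1..fst w}" by blast
  qed
qed auto

lemma pattern_count_self:
  assumes "w \<in> perms" shows "pattern_count w w = 1"
proof -
  have "I = {1..fst w}" if "I \<subseteq> {1..fst w}" "restrict_perm w I = w" for I
  proof (rule card_subset_eq)
    show "card I = card {1..fst w}" using fst_restrict_perm[of w I] that(2) by simp
  qed (use that(1) in auto)
  then have "{I. I \<subseteq> {1..fst w} \<and> restrict_perm w I = w} = {{1..fst w}}"
    using restrict_perm_full[OF assms] by blast
  then show ?thesis by (simp add: pattern_count_def)
qed

lemma pattern_count_nonzero:
  assumes "w \<in> perms" "pattern_count p w \<noteq> 0" shows "p = w \<or> fst p < fst w"
proof -
  obtain I where I: "I \<subseteq> {1..fst w}" "restrict_perm w I = p"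
    using assms(2) by (auto simp: pattern_count_def card_eq_0_iff)
  show ?thesis
  proof (cases "I = {1..fst w}")
    case True
    then show ?thesis using I restrict_perm_full[OF assms(1)] by simp
  next
    case False
    then have "card I < card {1..fst w}" using I by (intro psubset_card_mono) auto
    then show ?thesis using I by auto
  qed
qed

lemma pattern_sum_split:
  assumes "w \<in> perms"
  shows "(\<Sum>p | p \<in> perms \<and> pattern_count p w \<noteq> 0. c p * int (pattern_count p w)) =
    c w + (\<Sum>p | p \<in> perms \<and> pattern_count p w \<noteq> 0 \<and> fst p < fst w. c p * int (pattern_count p w))"
proof -
  have "w \<in> {p. p \<in> perms \<and> pattern_count p w \<noteq> 0}"
    using assms pattern_count_self[OF assms] by simp
  then have "{p. p \<in> perms \<and> pattern_count p w \<noteq> 0} =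
      insert w {p. p \<in> perms \<and> pattern_count p w \<noteq> 0 \<and> fst p < fst w}"
    using pattern_count_nonzero[OF assms] by blast
  moreover have "finite {p. p \<in> perms \<and> pattern_count p w \<noteq> 0 \<and> fst p < fst w}"
    by (rule finite_subset[OF _ finite_patterns[of w]]) auto
  ultimately show ?thesis using pattern_count_self[OF assms] by simp
qed

function expansion_coeffs :: "(perm \<Rightarrow> int) \<Rightarrow> perm \<Rightarrow> int" where
  "expansion_coeffs \<sigma> w = \<sigma> w -
     (\<Sum>p | p \<in> perms \<and> pattern_count p w \<noteq> 0 \<and> fst p < fst w.
        expansion_coeffs \<sigma> p * int (pattern_count p w))"
  by auto
termination by (relation "measure (\<lambda>(\<sigma>, w). fst w)") auto

declare expansion_coeffs.simps [simp del]

lemma pattern_expansion_exists: "pattern_expansion \<sigma> (expansion_coeffs \<sigma>)"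
  unfolding pattern_expansion_def
proof
  fix w assume "w \<in> perms"
  then show "\<sigma> w = (\<Sum>p | p \<in> perms \<and> pattern_count p w \<noteq> 0.
      expansion_coeffs \<sigma> p * int (pattern_count p w))"
    using expansion_coeffs.simps[of \<sigma> w] by (simp only: pattern_sum_split)
qed

lemma pattern_expansion_unique:
  assumes "pattern_expansion \<sigma> c" "pattern_expansion \<sigma> d" "p \<in> perms"
  shows "c p = d p"
  using assms(3)
proof (induction "fst p" arbitrary: p rule: less_induct)
  case less
  have "(\<Sum>q | q \<in> perms \<and> pattern_count q p \<noteq> 0 \<and> fst q < fst p. c q * int (pattern_count q p)) =
      (\<Sum>q | q \<in> perms \<and> pattern_count q p \<noteq> 0 \<and> fst q < fst p. d q * int (pattern_count q p))"
    using less by (intro sum.cong) auto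
  moreover have "\<sigma> p = (\<Sum>q | q \<in> perms \<and> pattern_count q p \<noteq> 0. c q * int (pattern_count q p))"
    "\<sigma> p = (\<Sum>q | q \<in> perms \<and> pattern_count q p \<noteq> 0. d q * int (pattern_count q p))"
    using assms(1,2) less.prems unfolding pattern_expansion_def by blast+
  ultimately show ?case unfolding pattern_sum_split[OF less.prems] by linarith
qed

lemma pattern_coeff_eq:
  assumes "pattern_expansion \<sigma> c" "p \<in> perms" shows "pattern_coeff \<sigma> p = c p"
  unfolding pattern_coeff_def
proof (rule the_equality)
  show "\<exists>d. pattern_expansion \<sigma> d \<and> d p = c p" using assms(1) by (intro exI[of _ c]) simp
  show "k = c p" if "\<exists>d. pattern_expansion \<sigma> d \<and> d p = k" for k
    using that pattern_expansion_unique[OF _ assms(1,2)] by auto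
qed

end

theory Submission
  imports Defs
begin

text \<open>
  Multiplying \<open>w\<close> on the right by \<open>s\<^sub>i\<close> swaps the entries \<open>i\<close> and \<open>i + 1\<close> of its one-line notation,
  so a reduced word of \<open>w\<close>, read from the right, is a way to sort the list \<open>M\<close> of values of \<open>w\<close> by
  swapping adjacent descents. In this form the restriction to \<open>I\<close> only forgets list entries: it
  passes from \<open>M\<close> to the sublist of the values in \<open>V = w ` I\<close>, and it keeps those swaps for which
  both entries lie in \<open>V\<close>. Nothing has to be standardized, because sorting only depends on relative
  order.

  The theorem says that \<open>rw w\<close> is the sum, over all \<open>I\<close>, of the number of essential reduced words
  of the restriction of \<open>w\<close> to \<open>I\<close>. This is proved by attaching to every sorting word \<open>y\<close> of \<open>M\<close> a
  set \<open>V\<close> of values, the least one for which \<open>y\<close> is a minimal lift; then \<open>y\<close> is recovered from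
  \<open>V\<close> and its restriction to \<open>V\<close>, and the restrictions that arise are the essential ones. Four facts
  make this work.

  \<^item> Minimal lifts are described locally (\<open>greedy\<close>). The lexicographically least lift always
    swaps the leftmost descent that it may swap, and a descent may be swapped if one of its entries
    is outside \<open>V\<close>, or if it is the pair whose swap is the next letter of the restricted word. Some
    descent may always be swapped, so such a lift exists (\<open>greedy_lift_exists\<close>), and any other lift
    is larger where it first differs (\<open>greedy_is_least\<close>).

  \<^item> If a greedy word passes over a descent \<open>(a, b)\<close> in order to swap a pair that is not
    contained in \<open>V\<close>, then it passes over \<open>(a, b)\<close> again at a later time
    (\<open>skipped_after_outside_step\<close>). Hence, by induction from the end of the word, the condition on
    \<open>(a, b)\<close> only needs to be checked at times at which the swapped pair is inside \<open>V\<close>.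

  \<^item> Consequently the sets \<open>V\<close> for which \<open>y\<close> is a minimal lift are closed under intersection
    (\<open>greedy_Int\<close>), so that there is a least one.

  \<^item> For the same reason minimal lifts compose: if \<open>y\<close> is the minimal lift of its restriction
    to \<open>V\<close>, and \<open>W \<subseteq> V\<close>, then \<open>y\<close> is minimal for \<open>W\<close> if and only if its restriction to \<open>V\<close> is
    (\<open>greedy_restrict_iff\<close>). Therefore \<open>V\<close> is the least set for \<open>y\<close> if and only if the restriction
    of \<open>y\<close> to \<open>V\<close> is essential.
\<close>

section \<open>Sorting a list by swapping adjacent descents\<close>

text \<open>
  Positions are counted from 0, so the letter \<open>i\<close> of a sorting word stands for the transposition
  of \<open>i + 1\<close> and \<open>i + 2\<close>.
\<close>

definition swap_at :: "nat \<Rightarrow> 'a list \<Rightarrow> 'a list" where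
  "swap_at i M = M[i := M ! Suc i, Suc i := M ! i]"

definition descent_at :: "nat list \<Rightarrow> nat \<Rightarrow> nat \<Rightarrow> nat \<Rightarrow> bool" where
  "descent_at M i a b \<longleftrightarrow> (\<exists>xs ys. M = xs @ a # b # ys \<and> i = length xs \<and> b < a)"

fun sorts :: "nat list \<Rightarrow> nat list \<Rightarrow> bool" where
  "sorts M [] \<longleftrightarrow> sorted M"
| "sorts M (i # y) \<longleftrightarrow> Suc i < length M \<and> M ! Suc i < M ! i \<and> sorts (swap_at i M) y"

text \<open>
  The pairs of values that are swapped, in order. This sequence is what restriction acts on by
  filtering, while letters have to be renumbered.
\<close>

fun created :: "nat list \<Rightarrow> nat list \<Rightarrow> (nat \<times> nat) list" where
  "created M [] = []"
| "created M (i # y) = (M ! i, M ! Suc i) # created (swap_at i M) y"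

text \<open>
  The values in \<open>V\<close> to the left of position \<open>i\<close> determine the position of the swap in the
  sublist.
\<close>

fun restrict_run :: "nat set \<Rightarrow> nat list \<Rightarrow> nat list \<Rightarrow> nat list" where
  "restrict_run V M [] = []"
| "restrict_run V M (i # y) =
     (if M ! i \<in> V \<and> M ! Suc i \<in> V then [length (filter (\<lambda>c. c \<in> V) (take i M))] else [])
       @ restrict_run V (swap_at i M) y"

text \<open>
  The word \<open>y\<close> never passes over a descent that a lift of its restriction to \<open>V\<close> might have
  swapped first: a descent to the left of the swap that is made lies inside \<open>V\<close>, and is not the
  next pair inside \<open>V\<close> to be swapped.
\<close>

fun greedy :: "nat set \<Rightarrow> nat list \<Rightarrow> nat list \<Rightarrow> bool" where
  "greedy V M [] \<longleftrightarrow> True"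
| "greedy V M (j # y) \<longleftrightarrow>
     (\<forall>i a b. i < j \<and> descent_at M i a b \<longrightarrow>
        a \<in> V \<and> b \<in> V \<and> find (\<lambda>p. p \<in> V \<times> V) (created M (j # y)) \<noteq> Some (a, b))
     \<and> greedy V (swap_at j M) y"

text \<open>
  At some time before it swaps \<open>(a, b)\<close>, the word \<open>y\<close> makes a swap to the right of the adjacent
  pair \<open>(a, b)\<close>. Asking that \<open>(a, b)\<close> has not been swapped before that time avoids having to know
  that a swapped pair never becomes a descent again.
\<close>

fun skipped :: "nat list \<Rightarrow> nat list \<Rightarrow> nat \<Rightarrow> nat \<Rightarrow> bool" where
  "skipped M [] a b \<longleftrightarrow> False"
| "skipped M (j # y) a b \<longleftrightarrow> (\<exists>i<j. descent_at M i a b) \<or>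
     ((M ! j, M ! Suc j) \<noteq> (a, b) \<and> skipped (swap_at j M) y a b)"

lemma split_at_adjacent:
  assumes "Suc i < length M"
  shows "M = take i M @ M ! i # M ! Suc i # drop (Suc (Suc i)) M"
  using assms Cons_nth_drop_Suc[of i M] Cons_nth_drop_Suc[of "Suc i" M] append_take_drop_id[of i M]
  by auto

lemma descent_at_nth:
  "descent_at M i a b \<longleftrightarrow> Suc i < length M \<and> M ! i = a \<and> M ! Suc i = b \<and> b < a"
proof
  assume "Suc i < length M \<and> M ! i = a \<and> M ! Suc i = b \<and> b < a"
  then have "M = take i M @ a # b # drop (Suc (Suc i)) M" "i = length (take i M)" "b < a"
    using split_at_adjacent[of i M] by auto
  then show "descent_at M i a b" unfolding descent_at_def by blast
qed (auto simp: descent_at_def nth_append)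

lemma descent_atI: "b < a \<Longrightarrow> descent_at (xs @ a # b # ys) (length xs) a b"
  unfolding descent_at_def by blast

lemma swap_at_append [simp]: "swap_at (length xs) (xs @ a # b # ys) = xs @ b # a # ys"
  by (simp add: swap_at_def list_update_append nth_append)

lemma length_swap_at [simp]: "length (swap_at i M) = length M"
  by (simp add: swap_at_def)

lemma sorts_ConsE:
  assumes "sorts M (i # y)"
  obtains xs a b ys where "M = xs @ a # b # ys" "i = length xs" "b < a" "sorts (xs @ b # a # ys) y"
    "swap_at i M = xs @ b # a # ys" "M ! i = a" "M ! Suc i = b"
proof -
  have "descent_at M i (M ! i) (M ! Suc i)" using assms by (simp add: descent_at_nth)
  then obtain xs ys where M: "M = xs @ M ! i # M ! Suc i # ys" "i = length xs" "M ! Suc i < M ! i"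
    unfolding descent_at_def by blast
  then have "swap_at i M = xs @ M ! Suc i # M ! i # ys" by (metis swap_at_append)
  then show thesis using that[OF M] assms by simp
qed

lemma mset_swap_at: "Suc i < length M \<Longrightarrow> mset (swap_at i M) = mset M"
  unfolding swap_at_def by (simp add: mset_swap)

lemma set_swap_at: "Suc i < length M \<Longrightarrow> set (swap_at i M) = set M"
  using mset_swap_at mset_eq_setD by metis

lemma distinct_swap_at: "Suc i < length M \<Longrightarrow> distinct (swap_at i M) = distinct M"
  using mset_swap_at mset_eq_imp_distinct_iff by metis

lemma find_filter: "find P xs = (case filter P xs of [] \<Rightarrow> None | x # _ \<Rightarrow> Some x)"
  by (induction xs) auto

text \<open>
  A swap inside \<open>V\<close> is a swap of neighbours in the sublist, and any other swap leaves the sublist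
  unchanged.
\<close>

lemma restriction_sorts_created:
  assumes "sorts M y"
  shows "sorts (filter (\<lambda>c. c \<in> V) M) (restrict_run V M y) \<and>
    created (filter (\<lambda>c. c \<in> V) M) (restrict_run V M y) = filter (\<lambda>p. p \<in> V \<times> V) (created M y)"
  using assms
proof (induction y arbitrary: M)
  case Nil
  then show ?case by (simp add: sorted_wrt_filter)
next
  case (Cons i y)
  from Cons.prems obtain xs a b ys where M: "M = xs @ a # b # ys" "i = length xs" "b < a"
    "sorts (xs @ b # a # ys) y" by (rule sorts_ConsE)
  note IH = Cons.IH[OF M(4)]
  show ?case
  proof (cases "a \<in> V \<and> b \<in> V")
    case True
    let ?X = "filter (\<lambda>c. c \<in> V) xs"
    have "restrict_run V M (i # y) = length ?X # restrict_run V (xs @ b # a # ys) y"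
      using True by (simp add: M nth_append)
    then show ?thesis using IH True M(3) by (simp add: M(1,2) nth_append)
  next
    case False
    then have "filter (\<lambda>c. c \<in> V) M = filter (\<lambda>c. c \<in> V) (xs @ b # a # ys)"
      "restrict_run V M (i # y) = restrict_run V (xs @ b # a # ys) y"
      by (auto simp: M nth_append)
    then show ?thesis using IH False by (auto simp: M nth_append)
  qed
qed

lemmas sorts_restrict_run = restriction_sorts_created[THEN conjunct1]
lemmas created_restrict_run = restriction_sorts_created[THEN conjunct2]

fun inv_count :: "nat list \<Rightarrow> nat" where
  "inv_count [] = 0"
| "inv_count (x # xs) = length (filter (\<lambda>z. z < x) xs) + inv_count xs"

lemma inv_count_swap: "b < a \<Longrightarrow> inv_count (xs @ a # b # ys) = Suc (inv_count (xs @ b # a # ys))"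
  by (induction xs) auto

text \<open>
  Two values that are out of order are separated by a descent. This supplies descents of the full
  list between neighbours of the sublist.
\<close>

lemma descent_between:
  assumes "b < (a :: nat)"
  shows "\<exists>us c d vs. a # zs @ [b] = us @ c # d # vs \<and> d < c"
  using assms
proof (induction zs arbitrary: a)
  case Nil
  then have "a # [] @ [b] = [] @ a # b # [] \<and> b < a" by simp
  then show ?case by blast
next
  case (Cons z zs)
  show ?case
  proof (cases "z < a")
    case True
    then have "a # (z # zs) @ [b] = [] @ a # z # (zs @ [b]) \<and> z < a" by simp
    then show ?thesis by blast
  next
    case False
    then have "b < z" using Cons.prems by simp
    from Cons.IH[OF this] obtain us c d vs where "z # zs @ [b] = us @ c # d # vs" "d < c" by blast
    then have "a # (z # zs) @ [b] = (a # us) @ c # d # vs \<and> d < c" by simp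
    then show ?thesis by blast
  qed
qed

lemma filter_eq_appendD:
  "filter P M = us @ ws \<Longrightarrow> \<exists>xs ys. M = xs @ ys \<and> filter P xs = us \<and> filter P ys = ws"
proof (induction us arbitrary: M)
  case (Cons u us)
  then obtain p N where M: "M = p @ u # N" "\<forall>x\<in>set p. \<not> P x" "P u" "us @ ws = filter P N"
    by (auto simp: filter_eq_Cons_iff)
  then obtain xs ys where "N = xs @ ys" "filter P xs = us" "filter P ys = ws"
    using Cons.IH[of N] by auto
  then have "M = (p @ u # xs) @ ys \<and> filter P (p @ u # xs) = u # us \<and> filter P ys = ws"
    using M by (simp add: filter_empty_conv)
  then show ?case by blast
qed (metis append_Nil filter.simps(1))

lemma filter_adjacent:
  assumes "filter P M = us @ a # b # vs"
  obtains xs zs ys where "M = xs @ a # zs @ b # ys" "filter P xs = us" "filter P zs = []"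
    "filter P ys = vs" "P a" "P b"
proof -
  obtain xs N where 1: "M = xs @ N" "filter P xs = us" "filter P N = a # b # vs"
    using filter_eq_appendD[OF assms] by metis
  obtain p N' where 2: "N = p @ a # N'" "\<forall>x\<in>set p. \<not> P x" "P a" "filter P N' = b # vs"
    using filter_eq_ConsD[OF 1(3)] by metis
  obtain zs ys where 3: "N' = zs @ b # ys" "\<forall>x\<in>set zs. \<not> P x" "P b" "vs = filter P ys"
    using filter_eq_ConsD[OF 2(4)] by metis
  have "filter P (xs @ p) = us" "filter P zs = []" using 1(2) 2(2) 3(2) by (auto simp: filter_empty_conv)
  moreover have "M = (xs @ p) @ a # zs @ b # ys" by (simp add: 1 2 3)
  ultimately show thesis using that 2(3) 3(3,4) by blast
qed

text \<open>
  A descent of the sublist need not be one of the full list, but the stretch of the full list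
  between its two entries contains a descent, and unless the two are adjacent, that descent has an
  entry outside \<open>V\<close>. The conditions on lengths locate this descent relative to positions of the
  sublist.
\<close>

lemma descent_from_filter_descent:
  assumes "descent_at (filter (\<lambda>c. c \<in> V) M) r a b"
  obtains i c d where "descent_at M i c d" "c \<in> V \<and> d \<in> V \<Longrightarrow> c = a \<and> d = b"
    "length (filter (\<lambda>c. c \<in> V) (take i M)) = r \<or> \<not> (c \<in> V \<and> d \<in> V)"
    "length (filter (\<lambda>c. c \<in> V) (take (Suc i) M)) \<le> Suc r"
proof -
  obtain us vs where uv: "filter (\<lambda>c. c \<in> V) M = us @ a # b # vs" "r = length us" "b < a"
    using assms unfolding descent_at_def by blast
  obtain xs zs ys where M: "M = xs @ a # zs @ b # ys" "filter (\<lambda>c. c \<in> V) xs = us"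
    "filter (\<lambda>c. c \<in> V) zs = []" "a \<in> V" "b \<in> V"
    using filter_adjacent[OF uv(1)] by metis
  obtain ps c d qs where p: "a # zs @ [b] = ps @ c # d # qs" "d < c"
    using descent_between[OF uv(3)] by blast
  have Meq: "M = (xs @ ps) @ c # d # (qs @ ys)" using p(1) M(1) by (metis append.assoc append_Cons append_Nil)
  then have D: "descent_at M (length (xs @ ps)) c d" unfolding descent_at_def using p(2) by blast
  have zs: "z \<notin> V" if "z \<in> set zs" for z using M(3) that by (auto simp: filter_empty_conv)
  have psa: "ps = [] \<and> c = a \<or> (\<exists>ps'. ps = a # ps' \<and> set ps' \<subseteq> set zs \<and> c \<in> set zs)"
  proof (cases ps)
    case (Cons e ps')
    have "e = a" "zs @ [b] = ps' @ c # d # qs" using p(1) Cons by auto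
    then have "zs = ps' @ c # butlast (d # qs)"
      by (metis append_butlast_last_id butlast_append butlast_snoc butlast.simps(2) list.distinct(1) append_Cons)
    then show ?thesis using Cons \<open>e = a\<close> by auto
  qed (use p in auto)
  have cd: "c = a \<and> d = b \<and> ps = []" if "c \<in> V \<and> d \<in> V"
  proof -
    have 1: "ps = [] \<and> c = a" using psa zs that by blast
    then have "zs @ [b] = d # qs" using p(1) by simp
    then have "d = b" using zs that by (cases zs) auto
    then show ?thesis using 1 by simp
  qed
  show thesis
  proof (rule that[OF D])
    show "c = a \<and> d = b" if "c \<in> V \<and> d \<in> V" using cd[OF that] by simp
    have "length (filter (\<lambda>c. c \<in> V) xs) = r" using M(2) uv(2) by simp
    then show "length (filter (\<lambda>c. c \<in> V) (take (length (xs @ ps)) M)) = r \<or> \<not> (c \<in> V \<and> d \<in> V)"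
      using cd by (auto simp: Meq)
    have "filter (\<lambda>c. c \<in> V) (ps @ [c]) = [a]"
      using psa zs M(4) by (auto simp: filter_empty_conv subset_iff)
    moreover have "take (Suc (length (xs @ ps))) M = xs @ ps @ [c]" by (simp add: Meq)
    ultimately show "length (filter (\<lambda>c. c \<in> V) (take (Suc (length (xs @ ps))) M)) \<le> Suc r"
      using M(2) uv(2) by simp
  qed
qed

lemma descent_in_filter:
  assumes "descent_at M i a b" "a \<in> V" "b \<in> V"
  shows "descent_at (filter (\<lambda>c. c \<in> V) M) (length (filter (\<lambda>c. c \<in> V) (take i M))) a b"
  using assms unfolding descent_at_def by fastforce

lemma descent_exists:
  assumes "\<not> sorted M" shows "\<exists>i a b. descent_at M i a b"
  using assms unfolding sorted_iff_nth_Suc descent_at_nth by (auto simp: not_le)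

lemma sorted_no_descent: "sorted M \<Longrightarrow> \<not> descent_at M i a b"
  unfolding sorted_iff_nth_Suc descent_at_nth by (auto simp: not_le[symmetric])

lemma sorts_Nil_word: "sorts M x \<Longrightarrow> sorted M \<Longrightarrow> x = []"
  by (cases x) (auto simp: sorted_iff_nth_Suc not_le[symmetric])

lemma descent_at_unique: "descent_at M i a b \<Longrightarrow> descent_at M j a b \<Longrightarrow> distinct M \<Longrightarrow> i = j"
  unfolding descent_at_nth by (metis nth_eq_iff_index_eq Suc_lessD)

section \<open>Minimal lifts are the greedy lifts\<close>

text \<open>
  Always swap the leftmost descent that is either not contained in \<open>V\<close> or required next by \<open>x\<close>.
  There is one as long as the list is not sorted: if \<open>x\<close> is not finished, then its next letter is a
  descent of the sublist, between whose entries a suitable descent of the full list is found.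
\<close>

lemma greedy_lift_exists:
  assumes "distinct M" "sorts (filter (\<lambda>c. c \<in> V) M) x"
  shows "\<exists>y. sorts M y \<and> restrict_run V M y = x \<and> greedy V M y"
  using assms
proof (induction "inv_count M" arbitrary: M x rule: less_induct)
  case less
  let ?F = "filter (\<lambda>c. c \<in> V) M"
  define ok where "ok i \<longleftrightarrow> Suc i < length M \<and> M ! Suc i < M ! i \<and>
    (M ! i \<in> V \<and> M ! Suc i \<in> V \<longrightarrow> x \<noteq> [] \<and> hd x = length (filter (\<lambda>c. c \<in> V) (take i M)))" for i
  show ?case
  proof (cases "sorted M")
    case True
    then have "sorted ?F" by (simp add: sorted_wrt_filter)
    then have "x = []" using less.prems(2) sorts_Nil_word by blast
    then have "sorts M [] \<and> restrict_run V M [] = x \<and> greedy V M []" using True by simp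
    then show ?thesis by blast
  next
    case False
    have "\<exists>i. ok i"
    proof (cases x)
      case Nil
      obtain i a b where D: "descent_at M i a b" using descent_exists[OF False] by blast
      have "\<not> (a \<in> V \<and> b \<in> V)"
        using less.prems(2) Nil sorted_no_descent[of ?F] descent_in_filter[OF D, of V] by auto
      then show ?thesis using D unfolding ok_def descent_at_nth by blast
    next
      case (Cons r x')
      then have "descent_at ?F r (?F ! r) (?F ! Suc r)" using less.prems(2) by (simp add: descent_at_nth)
      then obtain i c d where "descent_at M i c d"
        "length (filter (\<lambda>c. c \<in> V) (take i M)) = r \<or> \<not> (c \<in> V \<and> d \<in> V)"
        by (rule descent_from_filter_descent)
      then show ?thesis unfolding ok_def descent_at_nth using Cons by auto
    qed
    then obtain i where i: "ok i" "\<And>k. k < i \<Longrightarrow> \<not> ok k"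
      using exists_least_iff[of ok] by blast
    have "descent_at M i (M ! i) (M ! Suc i)" using i(1) unfolding ok_def descent_at_nth by simp
    then obtain xs a b ys where M: "M = xs @ a # b # ys" "i = length xs" "b < a"
      unfolding descent_at_def by blast
    define x' where "x' = (if a \<in> V \<and> b \<in> V then tl x else x)"
    have nth: "M ! i = a" "M ! Suc i = b" "take i M = xs" "swap_at i M = xs @ b # a # ys"
      by (auto simp: M nth_append)
    have x: "x = (if a \<in> V \<and> b \<in> V then [length (filter (\<lambda>c. c \<in> V) xs)] else []) @ x'"
      using i(1) unfolding ok_def x'_def nth by (cases x) auto
    have sx: "sorts (filter (\<lambda>c. c \<in> V) (xs @ b # a # ys)) x'"
    proof (cases "a \<in> V \<and> b \<in> V")
      case True
      then show ?thesis using less.prems(2) x by (simp add: M)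
    next
      case False
      then show ?thesis using less.prems(2) x by (auto simp: M)
    qed
    have "inv_count (xs @ b # a # ys) < inv_count M" using inv_count_swap[OF M(3)] by (simp add: M)
    moreover have "distinct (xs @ b # a # ys)" using less.prems(1) by (auto simp: M)
    ultimately obtain y where y: "sorts (xs @ b # a # ys) y" "restrict_run V (xs @ b # a # ys) y = x'"
      "greedy V (xs @ b # a # ys) y"
      using less.hyps sx by blast
    have s: "sorts M (i # y)" using i(1) y(1) unfolding ok_def by (simp add: nth)
    have r: "restrict_run V M (i # y) = x" using y(2) x by (simp add: nth)
    have "c \<in> V \<and> d \<in> V \<and> find (\<lambda>p. p \<in> V \<times> V) (created M (i # y)) \<noteq> Some (c, d)"
      if k: "k < i" "descent_at M k c d" for k c d
    proof -
      have V: "c \<in> V" "d \<in> V" and hd: "x = [] \<or> hd x \<noteq> length (filter (\<lambda>c. c \<in> V) (take k M))"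
        using i(2)[OF k(1)] k(2) unfolding ok_def descent_at_nth by auto
      have "filter (\<lambda>p. p \<in> V \<times> V) (created M (i # y)) = created ?F x"
        using created_restrict_run[OF s, of V] r by simp
      moreover have "q = length (filter (\<lambda>c. c \<in> V) (take k M))"
        if "x = q # x''" "?F ! q = c" "?F ! Suc q = d" for q x''
        using descent_at_unique[of ?F q c d] descent_in_filter[OF k(2) V] less.prems that
        by (auto simp: descent_at_nth)
      ultimately have "find (\<lambda>p. p \<in> V \<times> V) (created M (i # y)) \<noteq> Some (c, d)"
        using hd unfolding find_filter by (cases x) auto
      then show ?thesis using V by simp
    qed
    then have "greedy V M (i # y)" using y(3) unfolding greedy.simps nth by blast
    then show ?thesis using s r by blast
  qed
qed

text \<open>
  If a lift \<open>z\<close> of the same word had a smaller letter than \<open>y\<close> at the first difference, then \<open>z\<close>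
  would swap a descent that \<open>y\<close> passes over; being inside \<open>V\<close>, it would be the next pair in the
  common restriction, which is excluded for \<open>y\<close>.
\<close>

lemma greedy_is_least:
  assumes "sorts M y" "sorts M z" "restrict_run V M y = restrict_run V M z" "greedy V M y"
  shows "y \<le> z"
  using assms
proof (induction y arbitrary: M z)
  case (Cons j y)
  then obtain i z' where z: "z = i # z'"
    using sorts_Nil_word[OF Cons.prems(1)] by (cases z) auto
  have eq: "filter (\<lambda>p. p \<in> V \<times> V) (created M (j # y)) = filter (\<lambda>p. p \<in> V \<times> V) (created M z)"
    using created_restrict_run[OF Cons.prems(1), of V] created_restrict_run[OF Cons.prems(2), of V] Cons.prems(3)
    by simp
  consider "i < j" | "i = j" | "j < i" by linarith
  then show ?case
  proof cases
    case 1
    have "descent_at M i (M ! i) (M ! Suc i)" using Cons.prems(2) z by (simp add: descent_at_nth)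
    then have "M ! i \<in> V" "M ! Suc i \<in> V"
      "find (\<lambda>p. p \<in> V \<times> V) (created M (j # y)) \<noteq> Some (M ! i, M ! Suc i)"
      using Cons.prems(4) 1 by (auto simp del: created.simps)
    then show ?thesis unfolding find_filter eq z by simp
  next
    case 2
    have "y \<le> z'"
      by (rule Cons.IH[of "swap_at j M"]) (use Cons.prems 2 z in \<open>auto split: if_splits\<close>)
    then show ?thesis using 2 z by simp
  qed (simp add: z)
qed simp

text \<open>
  Passing over \<open>(a, b)\<close> at any time before it is swapped already gives the condition that being
  greedy imposes on \<open>(a, b)\<close> at the present time.
\<close>

lemma greedy_skipped:
  assumes "greedy V M y" "skipped M y a b"
  shows "a \<in> V \<and> b \<in> V \<and> find (\<lambda>p. p \<in> V \<times> V) (created M y) \<noteq> Some (a, b)"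
  using assms
proof (induction y arbitrary: M)
  case (Cons j y)
  show ?case
  proof (cases "\<exists>i<j. descent_at M i a b")
    case True
    then show ?thesis using Cons.prems(1) unfolding greedy.simps by blast
  next
    case False
    then have "(M ! j, M ! Suc j) \<noteq> (a, b)" "skipped (swap_at j M) y a b" using Cons.prems(2) by auto
    then show ?thesis using Cons.IH[of "swap_at j M"] Cons.prems(1) by auto
  qed
qed simp

section \<open>Sets with respect to which a word is greedy\<close>

text \<open>
  The situation in which a value \<open>c\<close> outside \<open>V\<close> has moved to the left past \<open>b\<close>, \<open>a\<close> and then \<open>Z\<close>.
  A swap of two values of \<open>X\<close> or of two neighbours in \<open>Z @ [a, b]\<close> would have been possible, and
  further left, before \<open>c\<close> started to move; the last assumption, which records that the word was
  greedy at that time, forbids it. As \<open>c\<close> cannot go back, it either continues to the left, or the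
  next swap is to the right of \<open>(a, b)\<close>.
\<close>

lemma skipped_during_run:
  assumes "distinct (X @ c # Z @ a # b # Y)" "sorts (X @ c # Z @ a # b # Y) y"
    "greedy V (X @ c # Z @ a # b # Y) y" "b < a" "\<forall>z\<in>set (Z @ [a]). c < z"
    "a \<in> V" "b \<in> V" "c \<notin> V"
    "\<And>i d e. descent_at (X @ Z @ [a, b]) i d e \<Longrightarrow> d \<in> V \<and> e \<in> V \<and>
       find (\<lambda>p. p \<in> V \<times> V) (created (X @ c # Z @ a # b # Y) y) \<noteq> Some (d, e)"
  shows "skipped (X @ c # Z @ a # b # Y) y a b"
  using assms
proof (induction y arbitrary: X Z)
  case Nil
  have "descent_at (X @ c # Z @ a # b # Y) (length (X @ c # Z)) a b"
    using descent_atI[OF Nil(4), of "X @ c # Z" Y] by simp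
  then show ?case using Nil(2) sorted_no_descent by auto
next
  case (Cons j y)
  let ?M = "X @ c # Z @ a # b # Y"
  have j: "Suc j < length ?M" "?M ! Suc j < ?M ! j" using Cons.prems(2) by auto
  have old: False if "descent_at (X @ Z @ [a, b]) i (?M ! j) (?M ! Suc j)" for i
    using Cons.prems(9)[OF that] by (simp split: if_split_asm)
  consider "Suc j < length X" | "Suc j = length X" | "j = length X"
    | "length X < j" "j \<le> Suc (length X + length Z)" | "Suc (length X + length Z) < j"
    by linarith
  then show ?case
  proof cases
    case 1
    then have "descent_at (X @ Z @ [a, b]) j (?M ! j) (?M ! Suc j)"
      using j(2) by (simp add: descent_at_nth nth_append)
    then show ?thesis using old by blast
  next
    case 2
    then obtain X' d where X: "X = X' @ [d]" "length X' = j" by (cases X rule: rev_cases) auto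
    have step: "swap_at j ?M = X' @ c # (d # Z) @ a # b # Y" "?M ! j = d" "?M ! Suc j = c"
      using X by (auto simp: nth_append)
    have bc: "b \<noteq> c" using Cons.prems(7,8) by blast
    have "skipped (X' @ c # (d # Z) @ a # b # Y) y a b"
    proof (rule Cons.IH)
      show "distinct (X' @ c # (d # Z) @ a # b # Y)" using Cons.prems(1) X by auto
      show "sorts (X' @ c # (d # Z) @ a # b # Y) y" "greedy V (X' @ c # (d # Z) @ a # b # Y) y"
        using Cons.prems(2,3) step by auto
      show "\<forall>z\<in>set ((d # Z) @ [a]). c < z" using Cons.prems(5) j(2) step by auto
      fix i f g
      assume "descent_at (X' @ (d # Z) @ [a, b]) i f g"
      then have "descent_at (X @ Z @ [a, b]) i f g" using X by simp
      then show "f \<in> V \<and> g \<in> V \<and> find (\<lambda>p. p \<in> V \<times> V) (created (X' @ c # (d # Z) @ a # b # Y) y)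
          \<noteq> Some (f, g)"
        using Cons.prems(9) Cons.prems(8) unfolding created.simps step by simp
    qed (use Cons.prems in auto)
    then show ?thesis using bc unfolding skipped.simps step by blast
  next
    case 3
    have "?M ! Suc j \<in> set (Z @ [a])" "?M ! j = c" using 3 by (cases Z; auto simp: nth_append)+
    then show ?thesis using Cons.prems(5) j(2) by (metis less_asym)
  next
    case 4
    have "?M ! j = (X @ Z @ [a, b]) ! (j - 1)" "?M ! Suc j = (X @ Z @ [a, b]) ! j"
      using 4 by (cases j; auto simp: nth_append nth_Cons' not_less less_Suc_eq_le
          intro!: arg_cong[where f = "nth Z"])+
    then have "descent_at (X @ Z @ [a, b]) (j - 1) (?M ! j) (?M ! Suc j)"
      using j(2) 4 by (auto simp: descent_at_nth)
    then show ?thesis using old by blast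
  next
    case 5
    have "descent_at ?M (length (X @ c # Z)) a b"
      using descent_atI[OF Cons.prems(4), of "X @ c # Z" Y] by simp
    then show ?thesis using 5 by auto
  qed
qed

text \<open>
  Suppose the word swaps the pair at position \<open>j\<close>, not contained in \<open>V\<close>, although the descent
  \<open>(a, b)\<close> lies further left. If the two pairs are disjoint, the next swap cannot be at or to the
  left of \<open>(a, b)\<close>, because it could have been made before, so \<open>(a, b)\<close> is passed over again. If
  they overlap in \<open>b\<close>, then \<open>a b c\<close> becomes \<open>a c b\<close> with \<open>c\<close> outside \<open>V\<close>; the descent
  \<open>(a, c)\<close> must then be swapped next, and \<open>c\<close> is on its way to the left as in
  \<open>skipped_during_run\<close>.
\<close>

lemma skipped_after_outside_step:
  assumes "distinct M" "sorts M (j # y)" "greedy V M (j # y)" "i < j" "descent_at M i a b"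
    "\<not> (M ! j \<in> V \<and> M ! Suc j \<in> V)"
  shows "skipped (swap_at j M) y a b"
proof -
  let ?N = "swap_at j M"
  have sN: "sorts ?N y" and gN: "greedy V ?N y" and j: "Suc j < length M" "M ! Suc j < M ! j"
    using assms(2,3) by auto
  have ab: "b < a" "M ! i = a" "M ! Suc i = b" using assms(5) by (auto simp: descent_at_nth)
  have D: "d \<in> V \<and> e \<in> V \<and> find (\<lambda>p. p \<in> V \<times> V) (created ?N y) \<noteq> Some (d, e)"
    if "k < j" "descent_at M k d e" for k d e
  proof -
    have "d \<in> V \<and> e \<in> V \<and> find (\<lambda>p. p \<in> V \<times> V) (created M (j # y)) \<noteq> Some (d, e)"
      using assms(3) that unfolding greedy.simps by blast
    then show ?thesis using assms(6) by auto
  qed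
  have V: "a \<in> V" "b \<in> V" using D[OF assms(4,5)] by auto
  have low: "?N ! k = M ! k" if "k < j" for k using that unfolding swap_at_def by simp
  \<comment> \<open>The next swap is not disjoint from and left of the swap at \<open>j\<close>: such a swap was possible before.\<close>
  have no_old: False if "y = k # y'" "Suc k < j" for k y'
  proof -
    have "descent_at ?N k (?N ! k) (?N ! Suc k)" using sN that by (auto simp: descent_at_nth)
    then have "descent_at M k (?N ! k) (?N ! Suc k)" using that low[of k] low[of "Suc k"] by (auto simp: descent_at_nth)
    from D[OF _ this] show False using that by (simp split: if_split_asm)
  qed
  show ?thesis
  proof (cases "Suc i = j")
    case False
    then have "descent_at ?N i a b" using assms(4) low ab j by (simp add: descent_at_nth)
    then obtain k y' where y: "y = k # y'" using sN sorted_no_descent by (cases y) auto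
    have "\<not> Suc k < j" using no_old[OF y] by blast
    then have "i < k" using False assms(4) by linarith
    then show ?thesis using \<open>descent_at ?N i a b\<close> y by auto
  next
    case True
    obtain X Y0 where M0: "M = X @ a # b # Y0" "i = length X"
      using assms(5) unfolding descent_at_def by blast
    then obtain c Y where M: "M = X @ a # b # c # Y" "j = Suc (length X)"
      using j True by (cases Y0) auto
    have N: "?N = X @ a # c # b # Y"
      using swap_at_append[of "X @ [a]" b c Y] M by simp
    have c: "c < b" "c \<notin> V" using j(2) assms(6) V M by (auto simp: nth_append)
    have dac: "descent_at ?N i a c" using descent_atI[of c a X "b # Y"] c ab by (simp add: N M0(2))
    then obtain k y' where y: "y = k # y'" using sN sorted_no_descent by (cases y) auto
    \<comment> \<open>Otherwise the descent \<open>(a, c)\<close> is passed over, which puts \<open>c\<close> into \<open>V\<close>.\<close>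
    have "\<not> i < k"
      using gN dac c(2) unfolding y greedy.simps by blast
    moreover have "\<not> Suc k < j" using no_old[OF y] by blast
    ultimately have k: "k = length X" using True M by simp
    have step: "swap_at k ?N = X @ c # [] @ a # b # Y" "?N ! k = a" "?N ! Suc k = c"
      by (simp_all add: N k nth_append)
    have "skipped (X @ c # [] @ a # b # Y) y' a b"
    proof (rule skipped_during_run)
      show "distinct (X @ c # [] @ a # b # Y)" using assms(1) M by auto
      show "sorts (X @ c # [] @ a # b # Y) y'" "greedy V (X @ c # [] @ a # b # Y) y'"
        using sN gN unfolding y sorts.simps greedy.simps step by auto
      fix l d e
      assume l: "descent_at (X @ [] @ [a, b]) l d e"
      then have "l < j" "descent_at M l d e" using M by (auto simp: descent_at_nth nth_append)
      then show "d \<in> V \<and> e \<in> V \<and> find (\<lambda>p. p \<in> V \<times> V) (created (X @ c # [] @ a # b # Y) y')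
          \<noteq> Some (d, e)"
        using D c(2) unfolding y created.simps step by simp
    qed (use V c ab in auto)
    then show ?thesis using c unfolding y skipped.simps step by blast
  qed
qed

text \<open>
  Induction along the word. If the current swap is inside \<open>V \<inter> W\<close>, then it is the next one there,
  and it is not the descent in question. Otherwise it is outside \<open>V\<close> or outside \<open>W\<close>, so that the
  descent is passed over again later, when the induction hypothesis applies.
\<close>

lemma greedy_Int:
  assumes "distinct M" "sorts M y" "greedy V M y" "greedy W M y"
  shows "greedy (V \<inter> W) M y"
  using assms
proof (induction y arbitrary: M)
  case (Cons j y)
  have j: "Suc j < length M" using Cons.prems(2) by simp
  have IH: "greedy (V \<inter> W) (swap_at j M) y"
    using Cons.IH[of "swap_at j M"] Cons.prems distinct_swap_at[OF j] by simp
  have "a \<in> V \<inter> W \<and> b \<in> V \<inter> W \<and>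
      find (\<lambda>p. p \<in> (V \<inter> W) \<times> (V \<inter> W)) (created M (j # y)) \<noteq> Some (a, b)"
    if i: "i < j" "descent_at M i a b" for i a b
  proof -
    have ab: "a \<in> V \<inter> W" "b \<in> V \<inter> W" using Cons.prems(3,4) i by auto
    show ?thesis
    proof (cases "M ! j \<in> V \<inter> W \<and> M ! Suc j \<in> V \<inter> W")
      case True
      \<comment> \<open>The current swap is the next one inside \<open>V \<inter> W\<close>; it differs from \<open>(a, b)\<close>, as \<open>i < j\<close>.\<close>
      have "M ! j \<noteq> a" using i j Cons.prems(1) by (auto simp: descent_at_nth nth_eq_iff_index_eq)
      then show ?thesis using True ab by simp
    next
      case False
      have "skipped (swap_at j M) y a b"
        using skipped_after_outside_step[OF Cons.prems(1,2,3) i]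
          skipped_after_outside_step[OF Cons.prems(1,2,4) i] False by blast
      then have "find (\<lambda>p. p \<in> (V \<inter> W) \<times> (V \<inter> W)) (created (swap_at j M) y) \<noteq> Some (a, b)"
        using greedy_skipped[OF IH] by blast
      then show ?thesis using ab False by auto
    qed
  qed
  then show ?case using IH unfolding greedy.simps by blast
qed simp

lemma find_created_restrict_run:
  assumes "sorts M y" "W \<subseteq> V"
  shows "find (\<lambda>p. p \<in> W \<times> W) (created (filter (\<lambda>c. c \<in> V) M) (restrict_run V M y)) =
    find (\<lambda>p. p \<in> W \<times> W) (created M y)"
proof -
  have "filter (\<lambda>p. p \<in> W \<times> W) (filter (\<lambda>p. p \<in> V \<times> V) ps) = filter (\<lambda>p. p \<in> W \<times> W) ps" for ps
    unfolding filter_filter using assms(2) by (intro filter_cong) auto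
  then show ?thesis unfolding created_restrict_run[OF assms(1)] find_filter by simp
qed

text \<open>
  When the current swap is inside \<open>V\<close>, the descents to its left are the same in the list and in the
  sublist: every descent of the list there is inside \<open>V\<close> because \<open>y\<close> is greedy, and then, by
  \<open>descent_from_filter_descent\<close>, every descent of the sublist there is adjacent in the list. When it
  is not inside \<open>V\<close>, the sublist and its word do not change, and the descents to the left are passed
  over again later.
\<close>

lemma greedy_restrict_iff:
  assumes "distinct M" "sorts M y" "greedy V M y" "W \<subseteq> V"
  shows "greedy W M y \<longleftrightarrow> greedy W (filter (\<lambda>c. c \<in> V) M) (restrict_run V M y)"
  using assms
proof (induction y arbitrary: M)
  case (Cons j y)
  from Cons.prems(2) obtain xs p q ys where M: "M = xs @ p # q # ys" "j = length xs" "q < p"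
    and N: "swap_at j M = xs @ q # p # ys" "sorts (xs @ q # p # ys) y" "M ! j = p" "M ! Suc j = q"
    by (rule sorts_ConsE)
  let ?N = "xs @ q # p # ys"
  let ?F = "\<lambda>xs. filter (\<lambda>c. c \<in> V) xs"
  have IH: "greedy W ?N y \<longleftrightarrow> greedy W (?F ?N) (restrict_run V ?N y)"
  proof (rule Cons.IH)
    show "distinct ?N" using Cons.prems(1) by (auto simp: M)
    show "greedy V ?N y" using Cons.prems(3) N(1) by simp
  qed (use N Cons.prems(4) in auto)
  have inV: "a \<in> V \<and> b \<in> V" if "i < j" "descent_at M i a b" for i a b
    using that Cons.prems(3) by auto
  show ?case
  proof (cases "p \<in> V \<and> q \<in> V")
    case True
    define r where "r = length (?F xs)"
    have step: "restrict_run V M (j # y) = r # restrict_run V ?N y"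
      using True by (simp add: nth_append r_def M(1,2))
    have sw: "swap_at r (?F M) = ?F ?N"
      using True swap_at_append[of "?F xs" p q "?F ys"] by (simp add: r_def M(1))
    note fd = find_created_restrict_run[OF Cons.prems(2,4), unfolded step]
    have "(\<forall>i a b. i < j \<and> descent_at M i a b \<longrightarrow> Q a b) \<longleftrightarrow>
      (\<forall>i a b. i < r \<and> descent_at (?F M) i a b \<longrightarrow> Q a b)" for Q
    proof (intro iffI allI impI; elim conjE)
      fix i a b
      assume Q: "\<forall>i a b. i < j \<and> descent_at M i a b \<longrightarrow> Q a b" and i: "i < r" "descent_at (?F M) i a b"
      obtain k c d where k: "descent_at M k c d" "c \<in> V \<and> d \<in> V \<Longrightarrow> c = a \<and> d = b"
        "length (?F (take (Suc k) M)) \<le> Suc i"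
        using descent_from_filter_descent[OF i(2)] by metis
      \<comment> \<open>Otherwise the prefix up to position \<open>k\<close> has more than \<open>r\<close> entries in \<open>V\<close>: those of \<open>xs\<close>, and \<open>p\<close>.\<close>
      have "k < j"
      proof (rule ccontr)
        assume "\<not> k < j"
        then have "take (Suc k) M = xs @ p # take (k - j) (q # ys)"
          using M(1,2) by (simp add: take_Cons' Suc_diff_le)
        then have "length (?F (take (Suc k) M)) \<ge> Suc r" using True by (simp add: r_def)
        then show False using k(3) i(1) by simp
      qed
      then show "Q a b" using Q k(1,2) inV by blast
    next
      fix i a b
      assume Q: "\<forall>i a b. i < r \<and> descent_at (?F M) i a b \<longrightarrow> Q a b" and i: "i < j" "descent_at M i a b"
      let ?k = "length (?F (take i M))"
      have "take (Suc i) M = take i M @ [a]" using i(2) by (simp add: descent_at_nth take_Suc_conv_app_nth)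
      then have "Suc ?k = length (?F (take (Suc i) M))" using inV[OF i] by simp
      moreover have "xs = take (Suc i) M @ drop (Suc i) xs" using i(1) M(1,2) by simp
      ultimately have "?k < r" unfolding r_def by (metis filter_append length_append le_add1 Suc_le_eq)
      then show "Q a b" using Q descent_in_filter[OF i(2)] inV[OF i] by blast
    qed
    then show ?thesis unfolding step greedy.simps fd N(1) sw IH by simp
  next
    case False
    then have step: "restrict_run V M (j # y) = restrict_run V ?N y" "?F M = ?F ?N" by (auto simp: nth_append M(1,2))
    have "greedy W M (j # y) \<longleftrightarrow> greedy W ?N y"
    proof
      assume W: "greedy W ?N y"
      have "a \<in> W \<and> b \<in> W \<and> find (\<lambda>p. p \<in> W \<times> W) (created M (j # y)) \<noteq> Some (a, b)"
        if i: "i < j" "descent_at M i a b" for i a b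
      proof -
        have "skipped ?N y a b"
          using skipped_after_outside_step[OF Cons.prems(1,2,3) i] False N by simp
        then show ?thesis using greedy_skipped[OF W] False Cons.prems(4) N by auto
      qed
      then show "greedy W M (j # y)" using W unfolding greedy.simps N(1) by blast
    qed (use N in simp)
    then show ?thesis using step IH by simp
  qed
qed simp

text \<open>
  With respect to the full set, the next pair to be swapped is always the current one, which is not
  the descent passed over.
\<close>

lemma greedy_full: "distinct M \<Longrightarrow> sorts M y \<Longrightarrow> greedy (set M) M y"
proof (induction y arbitrary: M)
  case (Cons j y)
  have j: "Suc j < length M" using Cons.prems(2) by simp
  have "greedy (set M) (swap_at j M) y"
    using Cons.IH[of "swap_at j M"] Cons.prems by (simp add: distinct_swap_at set_swap_at)
  moreover have "a \<in> set M \<and> b \<in> set M \<and>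
      find (\<lambda>p. p \<in> set M \<times> set M) (created M (j # y)) \<noteq> Some (a, b)"
    if "i < j" "descent_at M i a b" for i a b
  proof -
    have "M ! j \<noteq> a" using that j Cons.prems(1) by (auto simp: descent_at_nth nth_eq_iff_index_eq)
    then show ?thesis using that j by (auto simp: descent_at_nth)
  qed
  ultimately show ?case unfolding greedy.simps by blast
qed simp

section \<open>Counting sorting words by their essential restrictions\<close>

definition essential_run :: "nat list \<Rightarrow> nat list \<Rightarrow> bool" where
  "essential_run M y \<longleftrightarrow> sorts M y \<and> (\<forall>V. V \<subset> set M \<longrightarrow> \<not> greedy V M y)"

lemma length_sorts: "sorts M y \<Longrightarrow> length y = inv_count M"
proof (induction y arbitrary: M)
  case Nil
  then have "sorted M" by simp
  then have "inv_count M = 0"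
    by (induction M) (auto simp: filter_empty_conv not_less)
  then show ?case by simp
next
  case (Cons i y)
  from Cons.prems show ?case
    by (rule sorts_ConsE) (use Cons.IH inv_count_swap in simp)
qed

lemma set_sorts: "sorts M y \<Longrightarrow> set y \<subseteq> {..<length M}"
  by (induction y arbitrary: M) force+

lemma finite_sorts: "finite {y. sorts M y}"
  by (rule finite_subset[OF _ finite_lists_length_eq[of "{..<length M}" "inv_count M"]])
    (use set_sorts length_sorts in auto)

text \<open>
  The class of \<open>V\<close> consists of the words for which \<open>V\<close> is minimal among the sets with respect to
  which the word is greedy. By closure under intersection every word is in exactly one class, and
  restriction to \<open>V\<close> maps this class bijectively to the essential words of the sublist.
\<close>

lemma card_sorts:
  assumes "distinct M"
  shows "card {y. sorts M y} = (\<Sum>V\<in>Pow (set M). card {x. essential_run (filter (\<lambda>c. c \<in> V) M) x})"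
proof -
  define C where "C V = {y. sorts M y \<and> greedy V M y \<and> (\<forall>W. W \<subset> V \<longrightarrow> \<not> greedy W M y)}" for V
  have "{y. sorts M y} = (\<Union>V\<in>Pow (set M). C V)"
  proof
    show "{y. sorts M y} \<subseteq> (\<Union>V\<in>Pow (set M). C V)"
    proof
      fix y
      assume "y \<in> {y. sorts M y}"
      then have y: "sorts M y" by simp
      define G where "G = {V. V \<subseteq> set M \<and> greedy V M y}"
      have "finite G" "G \<noteq> {}" using greedy_full[OF assms y] unfolding G_def by auto
      then obtain V where V: "V \<in> G" "\<forall>W\<in>G. W \<subseteq> V \<longrightarrow> V = W"
        using finite_has_minimal[of G] by metis
      then have "y \<in> C V" unfolding C_def G_def using y by blast
      then show "y \<in> (\<Union>V\<in>Pow (set M). C V)" using V(1) unfolding G_def by blast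
    qed
  qed (auto simp: C_def)
  moreover have "card (\<Union>V\<in>Pow (set M). C V) = (\<Sum>V\<in>Pow (set M). card (C V))"
  proof (rule card_UN_disjoint)
    show "\<forall>V\<in>Pow (set M). finite (C V)"
      using finite_subset[OF _ finite_sorts[of M]] by (auto simp: C_def)
    show "\<forall>V\<in>Pow (set M). \<forall>W\<in>Pow (set M). V \<noteq> W \<longrightarrow> C V \<inter> C W = {}"
    proof (intro ballI impI equals0I)
      fix V W y
      assume VW: "V \<noteq> W" "y \<in> C V \<inter> C W"
      then have "greedy (V \<inter> W) M y" using greedy_Int[OF assms] by (simp add: C_def)
      then have "\<not> V \<inter> W \<subset> V" "\<not> V \<inter> W \<subset> W" using VW(2) unfolding C_def by auto
      then show False using VW(1) by blast
    qed
  qed simp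
  moreover have "card (C V) = card {x. essential_run (filter (\<lambda>c. c \<in> V) M) x}" if V: "V \<in> Pow (set M)" for V
  proof -
    let ?F = "filter (\<lambda>c. c \<in> V) M"
    have set: "set ?F = V" using V by auto
    have minimal: "(\<forall>W. W \<subset> V \<longrightarrow> \<not> greedy W M y) \<longleftrightarrow> (\<forall>W. W \<subset> V \<longrightarrow> \<not> greedy W ?F (restrict_run V M y))"
      if "sorts M y" "greedy V M y" for y
      using greedy_restrict_iff[OF assms that] by (metis psubset_imp_subset)
    have "inj_on (restrict_run V M) (C V)"
    proof (rule inj_onI)
      fix y z
      assume "y \<in> C V" "z \<in> C V" "restrict_run V M y = restrict_run V M z"
      then show "y = z" using greedy_is_least[of M y z V] greedy_is_least[of M z y V]
        by (auto simp: C_def)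
    qed
    moreover have "restrict_run V M ` C V = {x. essential_run ?F x}"
    proof
      show "restrict_run V M ` C V \<subseteq> {x. essential_run ?F x}"
      proof (intro image_subsetI CollectI)
        fix y assume "y \<in> C V"
        then have y: "sorts M y" "greedy V M y" "\<forall>W. W \<subset> V \<longrightarrow> \<not> greedy W M y"
          unfolding C_def by auto
        show "essential_run ?F (restrict_run V M y)"
          using minimal[OF y(1,2)] y(3) sorts_restrict_run[OF y(1)] unfolding essential_run_def set by simp
      qed
      show "{x. essential_run ?F x} \<subseteq> restrict_run V M ` C V"
      proof
        fix x assume "x \<in> {x. essential_run ?F x}"
        then have x: "essential_run ?F x" by simp
        then have "sorts ?F x" unfolding essential_run_def by simp
        then obtain y where y: "sorts M y" "restrict_run V M y = x" "greedy V M y"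
          using greedy_lift_exists[OF assms] by metis
        then have "y \<in> C V" "x = restrict_run V M y"
          using x minimal[OF y(1,3)] unfolding C_def essential_run_def set by simp_all
        then show "x \<in> restrict_run V M ` C V" by blast
      qed
    qed
    ultimately show ?thesis by (metis card_image)
  qed
  ultimately show ?thesis by simp
qed

section \<open>Reduced words sort the one-line notation\<close>

definition one_line :: "nat \<Rightarrow> (nat \<Rightarrow> nat) \<Rightarrow> nat list" where
  "one_line n w = map w [1..<Suc n]"

lemma length_one_line [simp]: "length (one_line n w) = n"
  by (simp add: one_line_def)

lemma nth_one_line [simp]: "i < n \<Longrightarrow> one_line n w ! i = w (Suc i)"
  by (simp add: one_line_def del: upt_Suc)

lemma set_one_line: "set (one_line n w) = w ` {1..n}"
  unfolding one_line_def by (simp add: atLeastLessThanSuc_atLeastAtMost del: upt_Suc)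

lemma set_one_line_permutes: "w permutes {1..n} \<Longrightarrow> set (one_line n w) = {1..n}"
  by (simp add: set_one_line permutes_image)

lemma distinct_one_line: "w permutes {1..n} \<Longrightarrow> distinct (one_line n w)"
  unfolding one_line_def
  by (simp add: distinct_map permutes_inj_on del: upt_Suc)

lemma one_line_comp_transpose:
  assumes "Suc i < n"
  shows "one_line n (w \<circ> transpose (Suc i) (Suc (Suc i))) = swap_at i (one_line n w)"
  using assms
  by (intro nth_equalityI) (auto simp: swap_at_def nth_list_update transpose_def)

lemma fold_word_prod: "fold (\<lambda>i f. transpose i (i + 1) \<circ> f) x g = word_prod x \<circ> (g :: nat \<Rightarrow> nat)"
proof (induction x arbitrary: g)
  case (Cons i x)
  have word: "word_prod (i # x) = word_prod x \<circ> (transpose i (i + 1) \<circ> id)"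
    unfolding Cons.IH[symmetric] by (simp only: word_prod_def fold_Cons comp_apply)
  have "fold (\<lambda>i f. transpose i (i + 1) \<circ> f) (i # x) g =
      fold (\<lambda>i f. transpose i (i + 1) \<circ> f) x (transpose i (i + 1) \<circ> g)"
    by (simp only: fold_Cons comp_apply)
  also have "\<dots> = word_prod (i # x) \<circ> g"
    unfolding Cons.IH word by (simp only: comp_id comp_assoc)
  finally show ?case .
qed (simp add: word_prod_def)

lemma word_prod_Nil [simp]: "word_prod [] = id"
  by (simp add: word_prod_def)

lemma word_prod_Cons: "word_prod (i # x) = word_prod x \<circ> transpose i (Suc i)"
  using fold_word_prod[of x "transpose i (Suc i)"] by (simp add: word_prod_def)

lemma word_prod_snoc: "word_prod (x @ [i]) = transpose i (Suc i) \<circ> word_prod x"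
  by (simp add: word_prod_def)

lemma bij_word_prod: "bij (word_prod x)"
proof (induction x)
  case (Cons i x)
  then show ?case unfolding word_prod_Cons by (intro bij_comp) simp_all
qed (unfold word_prod_Nil, rule bij_id)

lemma transpose_permutes:
  "Suc i < n \<Longrightarrow> w permutes {1..n} \<Longrightarrow> w \<circ> transpose (Suc i) (Suc (Suc i)) permutes {1..n}"
  by (rule permutes_compose) (auto intro: permutes_swap_id)

text \<open>
  The words for a permutation that need not be reduced correspond to sequences of adjacent swaps
  that may also create descents.
\<close>

fun swaps_sort :: "nat list \<Rightarrow> nat list \<Rightarrow> bool" where
  "swaps_sort M [] \<longleftrightarrow> sorted M"
| "swaps_sort M (i # y) \<longleftrightarrow> Suc i < length M \<and> swaps_sort (swap_at i M) y"

lemma word_iff_swaps_sort: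
  assumes "w permutes {1..n}"
  shows "map Suc y \<in> words_for (n, w) \<longleftrightarrow> swaps_sort (one_line n w) y"
  using assms
proof (induction y arbitrary: w)
  case Nil
  have "w = id" if "sorted (one_line n w)"
  proof -
    have "one_line n w = [1..<Suc n]"
      using that distinct_one_line[OF Nil] set_one_line_permutes[OF Nil]
      by (intro sorted_distinct_set_unique)
        (auto simp: atLeastLessThanSuc_atLeastAtMost simp del: upt_Suc)
    then have "\<forall>i\<in>{1..n}. w i = i"
      unfolding one_line_def by (simp add: map_idI map_eq_conv[of w _ id, simplified] del: upt_Suc)
    then show ?thesis using Nil permutes_not_in by fastforce
  qed
  moreover have "sorted (one_line n id)" by (simp add: one_line_def del: upt_Suc)
  ultimately show ?case by auto
next
  case (Cons i y)
  let ?s = "transpose (Suc i) (Suc (Suc i))"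
  have "word_prod (map Suc (i # y)) = w \<longleftrightarrow> word_prod (map Suc y) = w \<circ> ?s"
    unfolding list.map word_prod_Cons by (metis comp_assoc comp_id transpose_comp_involutory)
  then have words: "map Suc (i # y) \<in> words_for (n, w) \<longleftrightarrow>
      Suc i < n \<and> map Suc y \<in> words_for (n, w \<circ> ?s)" by auto
  note words
  also have "\<dots> \<longleftrightarrow> Suc i < n \<and> swaps_sort (swap_at i (one_line n w)) y"
    using Cons.IH[OF transpose_permutes[OF _ Cons.prems]] one_line_comp_transpose[of i n w]
    by (metis (no_types))
  finally show ?case by simp
qed

lemma word_for_is_map_Suc: "x \<in> words_for (n, w) \<Longrightarrow> \<exists>y. x = map Suc y"
proof -
  assume "x \<in> words_for (n, w)"
  then have "\<forall>i\<in>set x. Suc (i - 1) = i" by auto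
  then have "x = map Suc (map (\<lambda>i. i - 1) x)" by (auto simp: map_idI[symmetric] intro: map_idI[symmetric])
  then show ?thesis by blast
qed

lemma sorts_swaps_sort: "sorts M y \<Longrightarrow> swaps_sort M y"
  by (induction y arbitrary: M) auto

lemma inv_count_sorted: "sorted M \<Longrightarrow> inv_count M = 0"
  using length_sorts[of M "[]"] by simp

text \<open>
  Each swap changes the number of inversions by one, so the minimal number of swaps is reached
  exactly when every swap removes an inversion.
\<close>

lemma swaps_sort_length:
  assumes "swaps_sort M y" "distinct M"
  shows "inv_count M \<le> length y \<and> (length y = inv_count M \<longrightarrow> sorts M y)"
  using assms
proof (induction y arbitrary: M)
  case Nil
  then show ?case by (simp add: inv_count_sorted)
next
  case (Cons i y)
  have i: "Suc i < length M" using Cons.prems by simp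
  have IH: "inv_count (swap_at i M) \<le> length y \<and> (length y = inv_count (swap_at i M) \<longrightarrow> sorts (swap_at i M) y)"
    using Cons.IH[of "swap_at i M"] Cons.prems by (simp add: distinct_swap_at)
  have "i = length (take i M)" using i by simp
  then obtain xs a b ys where xs: "M = xs @ a # b # ys" "i = length xs"
    using split_at_adjacent[OF i] by blast
  have "a \<noteq> b" using Cons.prems(2) xs by auto
  then show ?case
    using IH inv_count_swap[of a b xs ys] inv_count_swap[of b a xs ys] xs
    by (cases "b < a") (auto simp: nth_append)
qed

lemma RW_eq:
  assumes "w permutes {1..n}"
  shows "RW (n, w) = map Suc ` {y. sorts (one_line n w) y}"
proof -
  let ?M = "one_line n w"
  note d = distinct_one_line[OF assms]
  obtain y0 where y0: "sorts ?M y0" using greedy_lift_exists[OF d, of "{}" "[]"] by auto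
  have le: "inv_count ?M \<le> length x" if "x \<in> words_for (n, w)" for x
  proof -
    obtain y where y: "x = map Suc y" using word_for_is_map_Suc[OF \<open>x \<in> _\<close>] by blast
    then have "swaps_sort ?M y" using \<open>x \<in> _\<close> word_iff_swaps_sort[OF assms] by blast
    then show ?thesis using swaps_sort_length[OF _ d] y by simp
  qed
  have iff: "map Suc y \<in> RW (n, w) \<longleftrightarrow> sorts ?M y" for y
  proof
    assume "map Suc y \<in> RW (n, w)"
    then have y: "map Suc y \<in> words_for (n, w)" "\<forall>x\<in>words_for (n, w). length (map Suc y) \<le> length x"
      unfolding RW_def by auto
    have "map Suc y0 \<in> words_for (n, w)"
      using y0 sorts_swaps_sort word_iff_swaps_sort[OF assms] by blast
    then have "length y \<le> inv_count ?M" using y(2) length_sorts[OF y0] by fastforce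
    then show "sorts ?M y" using y(1) word_iff_swaps_sort[OF assms] swaps_sort_length[OF _ d] le[OF y(1)]
      by simp
  next
    assume y: "sorts ?M y"
    then have "map Suc y \<in> words_for (n, w)"
      using sorts_swaps_sort word_iff_swaps_sort[OF assms] by blast
    then show "map Suc y \<in> RW (n, w)" unfolding RW_def using le length_sorts[OF y] by simp
  qed
  have "\<exists>y. x = map Suc y" if "x \<in> RW (n, w)" for x
    using that word_for_is_map_Suc unfolding RW_def by blast
  then show ?thesis using iff by auto
qed

text \<open>
  Two values in increasing order are never swapped.
\<close>

lemma sorts_keeps_order:
  assumes "sorts (one_line n w) y" "p < q" "w p < w q"
  shows "word_prod (map Suc (take k y)) p < word_prod (map Suc (take k y)) q"
  using assms
proof (induction y arbitrary: w p q k)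
  case (Cons i y)
  let ?s = "transpose (Suc i) (Suc (Suc i))"
  show ?case
  proof (cases k)
    case (Suc k')
    have i: "Suc i < n" "w (Suc (Suc i)) < w (Suc i)" "sorts (one_line n (w \<circ> ?s)) y"
      using Cons.prems(1) one_line_comp_transpose[of i n w] by auto
    have "?s p < ?s q"
      using Cons.prems(2,3) i(2) by (auto simp: transpose_def)
    then show ?thesis
      using Cons.IH[OF i(3), of "?s p" "?s q" k'] Cons.prems(3) Suc by (simp add: word_prod_Cons)
  qed (use Cons.prems in simp)
qed simp

lemma sorts_swaps_inversion:
  assumes "sorts (one_line n w) y" "k < length y"
    "word_prod (map Suc (take k y)) a = Suc (y ! k)"
    "word_prod (map Suc (take k y)) b = Suc (Suc (y ! k))"
  shows "w b < w a"
  using assms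
proof (induction y arbitrary: w a b k)
  case (Cons i y)
  let ?s = "transpose (Suc i) (Suc (Suc i))"
  have i: "Suc i < n" "w (Suc (Suc i)) < w (Suc i)" "sorts (one_line n (w \<circ> ?s)) y"
    using Cons.prems(1) one_line_comp_transpose[of i n w] by auto
  show ?case
  proof (cases k)
    case (Suc k')
    then show ?thesis
      using Cons.IH[OF i(3), of k' "?s a" "?s b"] Cons.prems by (simp add: word_prod_Cons)
  qed (use Cons.prems i in simp)
qed simp

text \<open>
  The two preceding lemmas make the condition \<open>a < b\<close> in the definition of an inversion automatic
  for a pair that is about to be swapped.
\<close>

lemma creates_iff:
  assumes "w permutes {1..n}" "sorts (one_line n w) y" "k < length y" "a \<in> {1..n}" "b \<in> {1..n}"
  shows "creates n (map Suc y) k (a, b) \<longleftrightarrow>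
    word_prod (take k (map Suc y)) a = Suc (y ! k) \<and> word_prod (take k (map Suc y)) b = Suc (Suc (y ! k))"
proof -
  let ?v = "word_prod (take k (map Suc y))" and ?j = "Suc (y ! k)"
  have v: "word_prod (take (k + 1) (map Suc y)) = transpose ?j (Suc ?j) \<circ> ?v"
    using assms(3) by (simp add: take_Suc_conv_app_nth word_prod_snoc)
  have "?v a \<noteq> ?v b" if "a \<noteq> b" using that bij_word_prod bij_is_inj injD by metis
  moreover have "a < b" if "?v a = ?j" "?v b = Suc ?j"
  proof (rule ccontr)
    have "w b < w a" using sorts_swaps_inversion[OF assms(2,3)] that by (simp add: take_map)
    moreover assume "\<not> a < b"
    moreover have "a \<noteq> b" using that by auto
    ultimately have "?v b < ?v a"
      using sorts_keeps_order[OF assms(2), of b a k] by (simp add: take_map)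
    then show False using that by simp
  qed
  ultimately show ?thesis
    unfolding creates_def inversions_def v using assms(4,5)
    by (auto simp: transpose_def split: if_splits)
qed

text \<open>
  Once the creation of a pair is expressed by current positions, both sides satisfy the same
  recursion, in which \<open>w\<close> and \<open>I\<close> are replaced by \<open>w \<circ> s\<close> and \<open>s ` I\<close> for the first
  transposition \<open>s\<close>, and the set of values \<open>w ` I\<close> stays the same.
\<close>

lemma restrict_word_eq:
  assumes "w permutes {1..n}" "sorts (one_line n w) y" "I \<subseteq> {1..n}"
  shows "restrict_word n I (map Suc y) = map Suc (restrict_run (w ` I) (one_line n w) y)"
proof -
  define rr where "rr I x = map (\<lambda>k. card {c \<in> word_prod (take k x) ` I. c \<le> x ! k})
      (filter (\<lambda>k. x ! k \<in> word_prod (take k x) ` I \<and> Suc (x ! k) \<in> word_prod (take k x) ` I)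
        [0..<length x])" for I x
  have image: "card {c \<in> I. f c \<le> m} = card {c \<in> f ` I. c \<le> m}" if "inj f" for f :: "nat \<Rightarrow> nat" and m
  proof -
    have "{c \<in> f ` I. c \<le> m} = f ` {c \<in> I. f c \<le> m}" by auto
    then show ?thesis by (simp only: card_image[OF inj_on_subset[OF that subset_UNIV]])
  qed
  have "(\<exists>a\<in>I. \<exists>b\<in>I. creates n (map Suc y) k (a, b)) \<longleftrightarrow>
      map Suc y ! k \<in> word_prod (take k (map Suc y)) ` I \<and>
      Suc (map Suc y ! k) \<in> word_prod (take k (map Suc y)) ` I" if "k < length y" for k
  proof -
    have "(\<exists>a\<in>I. \<exists>b\<in>I. creates n (map Suc y) k (a, b)) \<longleftrightarrow> (\<exists>a\<in>I. \<exists>b\<in>I.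
      word_prod (take k (map Suc y)) a = Suc (y ! k) \<and> word_prod (take k (map Suc y)) b = Suc (Suc (y ! k)))"
      using creates_iff[OF assms(1,2) that] assms(3) by (metis subsetD)
    then show ?thesis using that by (auto simp: image_iff) metis+
  qed
  then have "restrict_word n I (map Suc y) = rr I (map Suc y)"
    unfolding restrict_word_def rr_def
    by (intro map_cong filter_cong image bij_is_inj bij_word_prod) auto
  moreover have "rr I (map Suc y) = map Suc (restrict_run (w ` I) (one_line n w) y)"
    using assms
  proof (induction y arbitrary: w I)
    case Nil
    then show ?case by (simp add: rr_def)
  next
    case (Cons i y)
    let ?s = "transpose (Suc i) (Suc (Suc i))"
    have i: "Suc i < n" "sorts (one_line n (w \<circ> ?s)) y" "swap_at i (one_line n w) = one_line n (w \<circ> ?s)"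
      using Cons.prems(2) one_line_comp_transpose[of i n w] by auto
    have "?s ` I \<subseteq> {1..n}"
      using Cons.prems(3) i(1) by (auto simp: transpose_def)
    from Cons.IH[OF transpose_permutes[OF i(1) Cons.prems(1)] i(2) this]
    moreover have "(w \<circ> ?s) ` ?s ` I = w ` I" by (simp add: image_image)
    ultimately have IH: "rr (?s ` I) (map Suc y) = map Suc (restrict_run (w ` I) (one_line n (w \<circ> ?s)) y)"
      by (simp only:)
    have "rr I (Suc i # x) = (if Suc i \<in> I \<and> Suc (Suc i) \<in> I then [card {c \<in> I. c \<le> Suc i}] else [])
        @ rr (?s ` I) x" for x
    proof -
      have "[0..<length (Suc i # x)] = 0 # map Suc [0..<length x]"
        by (simp add: upt_conv_Cons map_Suc_upt del: upt_Suc)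
      then show ?thesis
        unfolding rr_def by (simp add: filter_map comp_def word_prod_Cons image_comp[symmetric] image_image)
    qed
    note step = this
    have inj: "inj w" using Cons.prems(1) permutes_inj by blast
    have "card {c \<in> I. c \<le> Suc i} = Suc (length (filter (\<lambda>c. c \<in> w ` I) (take i (one_line n w))))"
      if "Suc i \<in> I"
    proof -
      have "take i (one_line n w) = map w [1..<Suc i]"
        using i(1) by (simp add: one_line_def take_map take_upt del: upt_Suc)
      then have "length (filter (\<lambda>c. c \<in> w ` I) (take i (one_line n w))) = length (filter (\<lambda>c. c \<in> I) [1..<Suc i])"
        using inj by (simp add: filter_map comp_def inj_image_mem_iff del: upt_Suc)
      also have "\<dots> = card {c \<in> I. c \<le> i}"
      proof -
        have "set (filter (\<lambda>c. c \<in> I) [1..<Suc i]) = {c \<in> I. c \<le> i}"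
          using Cons.prems(3) by (auto simp del: upt_Suc)
        then show ?thesis using distinct_card[of "filter (\<lambda>c. c \<in> I) [1..<Suc i]"]
          by (simp del: upt_Suc)
      qed
      finally have *: "length (filter (\<lambda>c. c \<in> w ` I) (take i (one_line n w))) = card {c \<in> I. c \<le> i}" .
      have "{c \<in> I. c \<le> Suc i} = insert (Suc i) {c \<in> I. c \<le> i}" using that by auto
      then show ?thesis unfolding * by simp
    qed
    then show ?case using IH i(1,3) inj by (simp add: step inj_image_mem_iff)
  qed
  ultimately show ?thesis by simp
qed

section \<open>Restricted permutations and sublists\<close>

text \<open>
  The one-line notation of the restriction of \<open>w\<close> to \<open>I\<close> agrees with the sublist of the values in
  \<open>w ` I\<close> only up to an order isomorphism \<open>g\<close>. The following lemmas say that this does not matter.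
\<close>

lemma map_swap_at: "Suc i < length M \<Longrightarrow> swap_at i (map g M) = map g (swap_at i M)"
  by (simp add: swap_at_def map_update)

lemma sorts_map:
  assumes "strict_mono_on (set M) g"
  shows "sorts (map g M) y \<longleftrightarrow> sorts M y"
  using assms
proof (induction y arbitrary: M)
  case Nil
  have "g a \<le> g b \<longleftrightarrow> a \<le> b" if "a \<in> set M" "b \<in> set M" for a b
    using strict_mono_on_less_eq[OF Nil] that by blast
  then show ?case by (auto simp: sorted_iff_nth_Suc)
next
  case (Cons i y)
  have "strict_mono_on (set (swap_at i M)) g" if "Suc i < length M"
    using Cons.prems set_swap_at[OF that] by simp
  moreover have "g (M ! Suc i) < g (M ! i) \<longleftrightarrow> M ! Suc i < M ! i" if "Suc i < length M"
    using strict_mono_on_less[OF Cons.prems] that by simp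
  ultimately show ?case using Cons.IH[of "swap_at i M"] by (auto simp: map_swap_at)
qed

lemma created_map: "sorts M y \<Longrightarrow> created (map g M) y = map (map_prod g g) (created M y)"
  by (induction y arbitrary: M) (auto simp: map_swap_at)

lemma created_subset: "sorts M y \<Longrightarrow> set (created M y) \<subseteq> set M \<times> set M"
proof (induction y arbitrary: M)
  case (Cons i y)
  have i: "Suc i < length M" using Cons.prems by simp
  then show ?case using Cons.IH[of "swap_at i M"] Cons.prems by (simp add: set_swap_at)
qed simp

lemma greedy_map:
  assumes "strict_mono_on (set M) g" "V \<subseteq> set M" "sorts M y"
  shows "greedy (g ` V) (map g M) y \<longleftrightarrow> greedy V M y"
  using assms
proof (induction y arbitrary: M)
  case (Cons j y)
  have j: "Suc j < length M" "sorts (swap_at j M) y" using Cons.prems(3) by auto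
  have IH: "greedy (g ` V) (swap_at j (map g M)) y \<longleftrightarrow> greedy V (swap_at j M) y"
    using Cons.IH[of "swap_at j M"] Cons.prems j by (simp add: map_swap_at set_swap_at)
  have inj: "inj_on g (set M)" using Cons.prems(1) by (rule strict_mono_on_imp_inj_on)
  have mem: "g a \<in> g ` V \<longleftrightarrow> a \<in> V" if "a \<in> set M" for a
    using inj_on_image_mem_iff[OF inj that Cons.prems(2)] .
  let ?C = "created M (j # y)"
  have C: "set ?C \<subseteq> set M \<times> set M" by (rule created_subset) fact
  have "map_prod g g p \<in> g ` V \<times> g ` V \<longleftrightarrow> p \<in> V \<times> V" if "p \<in> set ?C" for p
  proof -
    obtain a b where p: "p = (a, b)" by (cases p)
    then have "a \<in> set M" "b \<in> set M" using that C by auto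
    then show ?thesis unfolding p map_prod_simp mem_Sigma_iff by (simp only: mem)
  qed
  then have "filter (\<lambda>p. p \<in> g ` V \<times> g ` V) (map (map_prod g g) ?C) =
      map (map_prod g g) (filter (\<lambda>p. p \<in> V \<times> V) ?C)"
    unfolding filter_map comp_def by (intro arg_cong[where f = "map _"] filter_cong refl)
  then have fd: "find (\<lambda>p. p \<in> g ` V \<times> g ` V) (created (map g M) (j # y)) =
      map_option (map_prod g g) (find (\<lambda>p. p \<in> V \<times> V) ?C)"
    unfolding created_map[OF Cons.prems(3)] find_filter by (simp split: list.split)
  have neq: "map_option (map_prod g g) (find (\<lambda>p. p \<in> V \<times> V) ?C) = Some (g a, g b) \<longleftrightarrow>
      find (\<lambda>p. p \<in> V \<times> V) ?C = Some (a, b)" if "a \<in> set M" "b \<in> set M" for a b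
  proof -
    have "c \<in> set M \<and> d \<in> set M" if "find (\<lambda>p. p \<in> V \<times> V) ?C = Some (c, d)" for c d
      using that C unfolding find_Some_iff by (metis mem_Sigma_iff nth_mem subsetD)
    then show ?thesis using that inj by (auto simp: inj_on_eq_iff)
  qed
  have D: "descent_at (map g M) i c d \<longleftrightarrow> (\<exists>a b. descent_at M i a b \<and> c = g a \<and> d = g b)" for i c d
    using strict_mono_on_less[OF Cons.prems(1)] by (auto simp: descent_at_nth)
  have set: "a \<in> set M \<and> b \<in> set M" if "descent_at M i a b" for i a b
    using that by (auto simp: descent_at_nth)
  have "(\<forall>i c d. i < j \<and> descent_at (map g M) i c d \<longrightarrow> c \<in> g ` V \<and> d \<in> g ` V \<and>
        find (\<lambda>p. p \<in> g ` V \<times> g ` V) (created (map g M) (j # y)) \<noteq> Some (c, d)) \<longleftrightarrow>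
      (\<forall>i a b. i < j \<and> descent_at M i a b \<longrightarrow> a \<in> V \<and> b \<in> V \<and>
        find (\<lambda>p. p \<in> V \<times> V) ?C \<noteq> Some (a, b))"
    unfolding fd D using set mem neq by (smt (verit))
  then show ?case unfolding greedy.simps IH by blast
qed simp

lemma essential_run_map:
  assumes "strict_mono_on (set M) g"
  shows "essential_run (map g M) y \<longleftrightarrow> essential_run M y"
proof -
  have inj: "inj_on g (set M)" using assms by (rule strict_mono_on_imp_inj_on)
  have "(\<forall>W. W \<subset> g ` set M \<longrightarrow> \<not> greedy W (map g M) y) \<longleftrightarrow> (\<forall>V. V \<subset> set M \<longrightarrow> \<not> greedy V M y)"
    if y: "sorts M y"
  proof (intro iffI allI impI)
    fix V assume "\<forall>W. W \<subset> g ` set M \<longrightarrow> \<not> greedy W (map g M) y" and V: "V \<subset> set M"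
    moreover have "g ` V \<subset> g ` set M" using inj V by (rule image_strict_mono)
    ultimately show "\<not> greedy V M y" using greedy_map[OF assms _ y, of V] by blast
  next
    fix W assume *: "\<forall>V. V \<subset> set M \<longrightarrow> \<not> greedy V M y" and W: "W \<subset> g ` set M"
    then obtain V where V: "V \<subseteq> set M" "W = g ` V" by (metis psubset_imp_subset subset_imageE)
    then have "V \<subset> set M" using W by blast
    then show "\<not> greedy W (map g M) y" using greedy_map[OF assms V(1) y] V(2) * by blast
  qed
  then show ?thesis unfolding essential_run_def sorts_map[OF assms] by auto
qed

lemma map_nth_elem:
  assumes "finite I"
  shows "map (nth_elem I) [1..<Suc (card I)] = sorted_list_of_set I"
  using assms by (intro nth_equalityI) (simp_all add: nth_elem_def del: upt_Suc)

lemma restrict_perm_one_line: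
  assumes "w permutes {1..n}" "I \<subseteq> {1..n}"
  obtains f g where "restrict_perm (n, w) I = (card I, f)" "f permutes {1..card I}"
    "strict_mono_on (set (one_line (card I) f)) g"
    "filter (\<lambda>c. c \<in> w ` I) (one_line n w) = map g (one_line (card I) f)"
proof -
  let ?h = "card I"
  define P where "P v \<longleftrightarrow> v permutes {1..?h} \<and> (\<forall>i\<in>{1..?h}. \<forall>j\<in>{1..?h}.
      v i < v j \<longleftrightarrow> w (nth_elem I i) < w (nth_elem I j))" for v :: "nat \<Rightarrow> nat"
  define f where "f = (THE v. P v)"
  have fin: "finite I" using assms(2) finite_subset by blast
  have "\<exists>!v. P v" unfolding P_def
    by (rule restrict_perm_ex1[OF _ assms(2)]) (use assms(1) in \<open>simp add: perms_def\<close>)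
  then have "P f" unfolding f_def by (rule theI')
  then have f: "f permutes {1..?h}"
    "\<And>i j. i \<in> {1..?h} \<Longrightarrow> j \<in> {1..?h} \<Longrightarrow> f i < f j \<longleftrightarrow> w (nth_elem I i) < w (nth_elem I j)"
    unfolding P_def by auto
  define g where "g = w \<circ> nth_elem I \<circ> inv f"
  have invf: "inv f (f i) = i" for i using f(1) by (simp add: permutes_inverses)
  show thesis
  proof (rule that)
    show "restrict_perm (n, w) I = (?h, f)" unfolding f_def P_def by simp
    show "strict_mono_on (set (one_line ?h f)) g"
      unfolding set_one_line using f(2) by (auto intro!: strict_mono_onI simp: g_def invf)
    have "sorted_list_of_set I = filter (\<lambda>c. c \<in> I) [1..<Suc n]"
      using fin assms(2) by (intro sorted_distinct_set_unique) (auto simp: sorted_wrt_filter simp del: upt_Suc)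
    moreover have "filter (\<lambda>c. c \<in> w ` I) (one_line n w) = map w (filter (\<lambda>c. c \<in> I) [1..<Suc n])"
      using permutes_inj[OF assms(1)]
      by (simp add: one_line_def filter_map comp_def inj_image_mem_iff del: upt_Suc)
    ultimately have "filter (\<lambda>c. c \<in> w ` I) (one_line n w) = map w (map (nth_elem I) [1..<Suc ?h])"
      using map_nth_elem[OF fin] by simp
    then show "filter (\<lambda>c. c \<in> w ` I) (one_line n w) = map g (one_line ?h f)"
      by (simp add: one_line_def g_def invf del: upt_Suc)
  qed (fact f(1))
qed

section \<open>Minimal lifts, essential words and the pattern expansion\<close>

lemma minimal_lift_image:
  assumes "w permutes {1..n}" "I \<subseteq> {1..n}"
  shows "minimal_lift (n, w) I ` RW (restrict_perm (n, w) I) =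
    map Suc ` {y. sorts (one_line n w) y \<and> greedy (w ` I) (one_line n w) y}"
proof -
  let ?M = "one_line n w" and ?V = "w ` I"
  let ?F = "filter (\<lambda>c. c \<in> ?V) ?M"
  note d = distinct_one_line[OF assms(1)]
  obtain f g where f: "restrict_perm (n, w) I = (card I, f)" "f permutes {1..card I}"
    "strict_mono_on (set (one_line (card I) f)) g" "?F = map g (one_line (card I) f)"
    using restrict_perm_one_line[OF assms] .
  have RWr: "RW (restrict_perm (n, w) I) = map Suc ` {x. sorts ?F x}"
    unfolding f(1) RW_eq[OF f(2)] f(4) sorts_map[OF f(3)] by (rule refl)
  have lift: "minimal_lift (n, w) I (map Suc (restrict_run ?V ?M y)) = map Suc y"
    if y: "sorts ?M y" "greedy ?V ?M y" for y
    unfolding minimal_lift_def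
  proof (rule Least_equality)
    show "map Suc y \<in> RW (n, w) \<and> restrict_word (fst (n, w)) I (map Suc y) = map Suc (restrict_run ?V ?M y)"
      using y RW_eq[OF assms(1)] restrict_word_eq[OF assms(1) y(1) assms(2)] by simp
    fix u assume u: "u \<in> RW (n, w) \<and> restrict_word (fst (n, w)) I u = map Suc (restrict_run ?V ?M y)"
    then obtain z where z: "u = map Suc z" "sorts ?M z" unfolding RW_eq[OF assms(1)] by auto
    then have "restrict_run ?V ?M y = restrict_run ?V ?M z"
      using u restrict_word_eq[OF assms(1) z(2) assms(2)] by (simp add: inj_map_eq_map)
    then have "y \<le> z" using greedy_is_least y z(2) by blast
    moreover have "map Suc as \<le> map Suc bs \<longleftrightarrow> as \<le> bs" for as bs :: "nat list"
      by (induction as arbitrary: bs; case_tac bs) auto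
    ultimately show "map Suc y \<le> u" using z(1) by simp
  qed
  show ?thesis
  proof
    show "minimal_lift (n, w) I ` RW (restrict_perm (n, w) I) \<subseteq>
        map Suc ` {y. sorts ?M y \<and> greedy ?V ?M y}"
    proof
      fix u assume "u \<in> minimal_lift (n, w) I ` RW (restrict_perm (n, w) I)"
      then obtain x where x: "sorts ?F x" "u = minimal_lift (n, w) I (map Suc x)"
        unfolding RWr by auto
      obtain y where "sorts ?M y" "restrict_run ?V ?M y = x" "greedy ?V ?M y"
        using greedy_lift_exists[OF d x(1)] by metis
      then show "u \<in> map Suc ` {y. sorts ?M y \<and> greedy ?V ?M y}" using lift[of y] x(2) by auto
    qed
    show "map Suc ` {y. sorts ?M y \<and> greedy ?V ?M y} \<subseteq>
        minimal_lift (n, w) I ` RW (restrict_perm (n, w) I)"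
    proof
      fix u assume "u \<in> map Suc ` {y. sorts ?M y \<and> greedy ?V ?M y}"
      then obtain y where y: "u = map Suc y" "sorts ?M y" "greedy ?V ?M y" by auto
      have "map Suc (restrict_run ?V ?M y) \<in> RW (restrict_perm (n, w) I)"
        unfolding RWr using sorts_restrict_run[OF y(2)] by simp
      then show "u \<in> minimal_lift (n, w) I ` RW (restrict_perm (n, w) I)"
        using lift[OF y(2,3)] y(1) by (metis imageI)
    qed
  qed
qed

lemma essential_eq:
  assumes "w permutes {1..n}"
  shows "{x. essential (n, w) x} = map Suc ` {y. essential_run (one_line n w) y}"
proof -
  let ?M = "one_line n w"
  have inj: "inj w" using assms by (rule permutes_inj)
  have iff: "essential (n, w) (map Suc y) \<longleftrightarrow> essential_run ?M y" for y
  proof (cases "sorts ?M y")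
    case True
    have "map Suc y \<in> minimal_lift (n, w) I ` RW (restrict_perm (n, w) I) \<longleftrightarrow> greedy (w ` I) ?M y"
      if "I \<subset> {1..n}" for I
      using minimal_lift_image[OF assms, of I] that True by (auto simp: inj_map_eq_map)
    then have "essential (n, w) (map Suc y) \<longleftrightarrow> (\<forall>I. I \<subset> {1..n} \<longrightarrow> \<not> greedy (w ` I) ?M y)"
      using True unfolding essential_def RW_eq[OF assms] by auto
    also have "\<dots> \<longleftrightarrow> (\<forall>V. V \<subset> w ` {1..n} \<longrightarrow> \<not> greedy V ?M y)"
    proof (intro iffI allI impI)
      fix V assume *: "\<forall>I. I \<subset> {1..n} \<longrightarrow> \<not> greedy (w ` I) ?M y" and V: "V \<subset> w ` {1..n}"
      then obtain I where I: "I \<subseteq> {1..n}" "V = w ` I" by (metis psubset_imp_subset subset_imageE)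
      then have "I \<subset> {1..n}" using V by blast
      then show "\<not> greedy V ?M y" using * I(2) by blast
    next
      fix I assume *: "\<forall>V. V \<subset> w ` {1..n} \<longrightarrow> \<not> greedy V ?M y" and I: "I \<subset> {1..n}"
      have "w ` I \<subset> w ` {1..n}"
        by (rule image_strict_mono[OF _ I]) (rule inj_on_subset[OF inj subset_UNIV])
      then show "\<not> greedy (w ` I) ?M y" using * by blast
    qed
    finally show ?thesis using True unfolding essential_run_def set_one_line by simp
  next
    case False
    then show ?thesis unfolding essential_def essential_run_def RW_eq[OF assms] by (auto simp: inj_map_eq_map)
  qed
  have "\<exists>y. x = map Suc y" if "essential (n, w) x" for x
    using that unfolding essential_def RW_eq[OF assms] by blast
  then show ?thesis using iff by auto
qed

lemma card_map_Suc: "card (map Suc ` A) = card A"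
  by (rule card_image) (simp add: inj_on_def inj_map_eq_map)

lemma rw_eq_sum_essential:
  assumes "(n, w) \<in> perms"
  shows "rw (n, w) = (\<Sum>I\<in>Pow {1..n}. card {x. essential (restrict_perm (n, w) I) x})"
proof -
  have w: "w permutes {1..n}" using assms by (simp add: perms_def)
  let ?M = "one_line n w"
  have "rw (n, w) = (\<Sum>V\<in>Pow (set ?M). card {x. essential_run (filter (\<lambda>c. c \<in> V) ?M) x})"
    unfolding rw_def RW_eq[OF w] card_map_Suc by (rule card_sorts[OF distinct_one_line[OF w]])
  also have "\<dots> = (\<Sum>I\<in>Pow {1..n}. card {x. essential_run (filter (\<lambda>c. c \<in> w ` I) ?M) x})"
    unfolding set_one_line image_Pow_surj[OF refl, of w "{1..n}", symmetric]
      sum.reindex[OF inj_on_image_Pow[OF permutes_inj_on[OF w]]] comp_def by (rule refl)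
  also have "\<dots> = (\<Sum>I\<in>Pow {1..n}. card {x. essential (restrict_perm (n, w) I) x})"
  proof (rule sum.cong[OF refl])
    fix I assume "I \<in> Pow {1..n}"
    then have "I \<subseteq> {1..n}" by simp
    then obtain f g where f: "restrict_perm (n, w) I = (card I, f)" "f permutes {1..card I}"
      "strict_mono_on (set (one_line (card I) f)) g"
      "filter (\<lambda>c. c \<in> w ` I) ?M = map g (one_line (card I) f)"
      using restrict_perm_one_line[OF w] by metis
    show "card {x. essential_run (filter (\<lambda>c. c \<in> w ` I) ?M) x} = card {x. essential (restrict_perm (n, w) I) x}"
      unfolding f(1,4) essential_eq[OF f(2)] card_map_Suc essential_run_map[OF f(3)] by (rule refl)
  qed
  finally show ?thesis .
qed

text \<open>
  Grouping the subsets \<open>I\<close> in \<open>rw_eq_sum_essential\<close> by the pattern that they carry.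
\<close>

lemma pattern_expansion_rw:
  "pattern_expansion (\<lambda>w. int (rw w)) (\<lambda>p. int (card {x. essential p x}))"
  unfolding pattern_expansion_def
proof
  fix w :: perm assume w: "w \<in> perms"
  let ?e = "\<lambda>p. int (card {x. essential p x})" and ?A = "Pow {1..fst w}"
  have patterns: "restrict_perm w ` ?A = {p. p \<in> perms \<and> pattern_count p w \<noteq> 0}"
  proof
    have "finite {I. I \<subseteq> {1..fst w} \<and> restrict_perm w I = p}" for p
      by (rule finite_subset[of _ ?A]) auto
    then show "restrict_perm w ` ?A \<subseteq> {p. p \<in> perms \<and> pattern_count p w \<noteq> 0}"
      using restrict_perm_in_perms[OF w] by (auto simp: pattern_count_def)
    show "{p. p \<in> perms \<and> pattern_count p w \<noteq> 0} \<subseteq> restrict_perm w ` ?A"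
    proof
      fix p assume "p \<in> {p. p \<in> perms \<and> pattern_count p w \<noteq> 0}"
      then have "{I. I \<subseteq> {1..fst w} \<and> restrict_perm w I = p} \<noteq> {}"
        unfolding pattern_count_def by (auto intro: ccontr)
      then show "p \<in> restrict_perm w ` ?A" by blast
    qed
  qed
  have "int (rw w) = (\<Sum>I\<in>?A. ?e (restrict_perm w I))"
    using rw_eq_sum_essential[of "fst w" "snd w"] w by simp
  also have "\<dots> = (\<Sum>p\<in>restrict_perm w ` ?A. \<Sum>I | I \<in> ?A \<and> restrict_perm w I = p. ?e (restrict_perm w I))"
    by (rule sum.image_gen) simp
  also have "\<dots> = (\<Sum>p | p \<in> perms \<and> pattern_count p w \<noteq> 0. ?e p * int (pattern_count p w))"
    unfolding patterns by (rule sum.cong) (auto simp: pattern_count_def)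
  finally show "int (rw w) = (\<Sum>p | p \<in> perms \<and> pattern_count p w \<noteq> 0. ?e p * int (pattern_count p w))" .
qed

theorem corollary4p11:
  shows "pattern_positive (\<lambda>w. int (rw w)) \<and>
    (\<forall>p\<in>perms. pattern_coeff (\<lambda>w. int (rw w)) p = int (card {x. essential p x}))"
  using pattern_coeff_eq[OF pattern_expansion_rw] by (simp add: pattern_positive_def)

end
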